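(* With probability one there exists $n_0$ such that for every $n\ge n_0$ the function $\mathbb R^3\ni(\alpha',\theta_1',\theta_2')\mapsto Q_n(\mathbf Y_n;\alpha',\theta_1',\theta_2')$ has a unique global minimizer, denoted $(\tilde\alpha_n,\tilde\theta_{1,n},\tilde\theta_{2,n})$. Moreover, for every $(\alpha,\theta_1,\theta_2)\in(0,1)\times\mathbb N^2$, almost surely $\tilde\alpha_n\to\alpha$ and, for $i=1,2$, $$\tilde\theta_{i,n}\to Y_{s_i}-\frac{\alpha}{1+\alpha^2}(Y_{s_i-1}+Y_{s_i+1})-\frac{1-\alpha}{1+\alpha^2}\mu_\varepsilon\qquad(n\to\infty).$$
   Context: INAR(1) process: Let $\alpha\in(0,1)$. Let $(\varepsilon_k)_{k\in\mathbb N}$ be i.i.d. non-negative integer-valued random variables with $\mathbb E\varepsilon_1^2<\infty$ and $\mathbb P(\varepsilon_1\ne 0)>0$; write $\mu_\varepsilon=\mathbb E\varepsilon_1$ (assumed known). For each $k\in\mathbb N$ let $(\xi_{k,j})_{j\in\mathbb N}$ be i.i.d. Bernoulli random variables with mean $\alpha$, these sequences being mutually independent and independent of $(\varepsilon_k)$. Let $X_0$ be a non-negative integer-valued random variable with $\mathbb E X_0^2<\infty$, independent of all $\xi_{k,j}$ and $\varepsilon_k$, and set $X_k=\sum_{j=1}^{X_{k-1}}\xi_{k,j}+\varepsilon_k$ for $k\in\mathbb N$. Two non-neighbouring additive outliers: fix known times $s_1,s_2\in\mathbb N$ with $s_1<s_2-1$ and sizes $\theta_1,\theta_2\in\mathbb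 N$; let $Y_k=X_k+\delta_{k,s_1}\theta_1+\delta_{k,s_2}\theta_2$, $k\in\mathbb Z_+$; $\mathbf Y_n=(Y_0,\dots,Y_n)$. For $n\ge s_2+1$, $$Q_n(\mathbf y_n;\alpha',\theta_1',\theta_2')=\sum_{\substack{k=1\\k\notin\{s_1,s_1+1,s_2,s_2+1\}}}^n(y_k-\alpha'y_{k-1}-\mu_\varepsilon)^2+\sum_{i=1}^2\Big[(y_{s_i}-\alpha'y_{s_i-1}-\mu_\varepsilon-\theta_i')^2+(y_{s_i+1}-\alpha'y_{s_i}-\mu_\varepsilon+\alpha'\theta_i')^2\Big].$$ *)

theory Defs
  imports "HOL-Probability.Probability"
begin

text \<open>Conditional least squares objective Q_n for the INAR(1) model with two
  non-neighbouring additive outliers at times s1, s2. Here mu is the (known)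
  innovation mean, y the observed path, a = alpha', t1 = theta_1', t2 = theta_2'.\<close>
definition Qn :: "real \<Rightarrow> nat \<Rightarrow> nat \<Rightarrow> nat \<Rightarrow> (nat \<Rightarrow> real) \<Rightarrow> real \<Rightarrow> real \<Rightarrow> real \<Rightarrow> real" where
  "Qn mu s1 s2 n y a t1 t2 =
     (\<Sum>k\<in>{1..n} - {s1, s1+1, s2, s2+1}. (y k - a * y (k-1) - mu)^2)
     + ((y s1 - a * y (s1-1) - mu - t1)^2 + (y (s1+1) - a * y s1 - mu + a * t1)^2)
     + ((y s2 - a * y (s2-1) - mu - t2)^2 + (y (s2+1) - a * y s2 - mu + a * t2)^2)"

definition Yobs :: "(nat \<Rightarrow> 'a \<Rightarrow> nat) \<Rightarrow> nat \<Rightarrow> nat \<Rightarrow> nat \<Rightarrow> nat \<Rightarrow> nat \<Rightarrow> 'a \<Rightarrow> real" where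
  "Yobs X s1 s2 \<theta>1 \<theta>2 k \<omega> =
     real (X k \<omega>) + (if k = s1 then real \<theta>1 else 0) + (if k = s2 then real \<theta>2 else 0)"

text \<open>The (global) minimizer of Q_n, meaningful when it is unique.\<close>
definition CLS_est :: "real \<Rightarrow> nat \<Rightarrow> nat \<Rightarrow> nat \<Rightarrow> (nat \<Rightarrow> real) \<Rightarrow> real \<times> real \<times> real" where
  "CLS_est mu s1 s2 n y =
     (THE p. \<forall>q. Qn mu s1 s2 n y (fst p) (fst (snd p)) (snd (snd p))
                  \<le> Qn mu s1 s2 n y (fst q) (fst (snd q)) (snd (snd q)))"

end

theory Submission
  imports Defs
begin

text \<open>For fixed \<open>a\<close> the objective is quadratic in the outlier sizes; minimizing them out leaves
  \<open>S (a - c)\<^sup>2\<close> plus a bounded rational function of \<open>a\<close> with bounded second derivative that does not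
  depend on \<open>n\<close>. Hence the minimizer is unique once \<open>S\<close> is large, and it lies within \<open>O (1 / sqrt S)\<close>
  of the least squares ratio \<open>c\<close>. It remains to show \<open>S \<longlonglongrightarrow> \<infinity>\<close> and \<open>c \<longlonglongrightarrow> \<alpha>\<close> almost surely.

  Let \<open>A\<^sub>k = 1 + (\<Sum>i\<le>k. X\<^sub>i\<^sup>2)\<close> and let \<open>R\<^sub>k = X\<^sub>k\<^sub>+\<^sub>1 - \<alpha> X\<^sub>k - \<mu>\<close>. The differences \<open>X\<^sub>k R\<^sub>k / A\<^sub>k\<close> form a
  martingale difference sequence with conditional variance at most a constant times
  \<open>X\<^sub>k\<^sup>2 (X\<^sub>k + 1) / A\<^sub>k\<^sup>2\<close>. As \<open>X\<^sub>k \<le> sqrt A\<^sub>k\<close>, this is bounded by \<open>2 (A\<^sub>k - A\<^sub>k\<^sub>-\<^sub>1) / A\<^sub>k powr (3/2)\<close>, whose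
  sum telescopes to a deterministic bound, so second moments suffice and no ergodic theorem is
  needed. The martingale converges almost surely, and Kronecker's lemma gives
  \<open>(\<Sum>k\<le>n. X\<^sub>k R\<^sub>k) / A\<^sub>n \<longlonglongrightarrow> 0\<close>; the outliers alter only finitely many summands.\<close>

subsection \<open>Profiling out the outlier sizes\<close>

text \<open>The minimizer in \<open>t\<close> of the two terms of \<open>Qn\<close> around an outlier time \<open>s\<close>, where \<open>q\<close>, \<open>u\<close>, \<open>p\<close>
  are the observations at \<open>s - 1\<close>, \<open>s\<close>, \<open>s + 1\<close>.\<close>
definition outlier_profile :: "real \<Rightarrow> real \<Rightarrow> real \<Rightarrow> real \<Rightarrow> real \<Rightarrow> real" where
  "outlier_profile mu q u p a = u - a / (1 + a^2) * (q + p) - (1 - a) / (1 + a^2) * mu"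

lemma one_plus_square_pos: "0 < 1 + (a::real)^2"
  by (smt (verit) zero_le_power2)

text \<open>The last two lines are the polynomial division of \<open>(p - mu - a mu - a\<^sup>2 q)\<^sup>2 / (1 + a\<^sup>2)\<close>.\<close>
lemma outlier_block_eq:
  fixes a q u p mu t :: real
  defines "c \<equiv> p - mu + q"
  shows "(u - a * q - mu - t)^2 + (p - a * u - mu + a * t)^2
    = (1 + a^2) * (t - outlier_profile mu q u p a)^2
      + q^2 * (1 + a^2) - 2 * q * (c - mu * a) + mu^2
      + (c^2 - mu^2 + (- 2 * c * mu) * a) / (1 + a^2)"
proof -
  define w where "w = 1 + a^2"
  have w: "w > 0" unfolding w_def by (rule one_plus_square_pos)
  define T where "T = outlier_profile mu q u p a"
  have T: "w * T = w * u - a * (q + p) - (1 - a) * mu"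
    using w by (simp add: T_def outlier_profile_def w_def[symmetric] field_simps)
  have "w * ((u - a * q - mu - t)^2 + (p - a * u - mu + a * t)^2)
     = (w * t - w * T)^2 + w * (q^2 * w - 2 * q * (c - mu * a) + mu^2)
       + (c^2 - mu^2 + (- 2 * c * mu) * a)"
    unfolding T unfolding w_def c_def by algebra
  also have "\<dots> = w * (w * (t - T)^2 + q^2 * w - 2 * q * (c - mu * a) + mu^2
      + (c^2 - mu^2 + (- 2 * c * mu) * a) / w)"
    using w by (simp add: field_simps power2_eq_square)
  finally show ?thesis using w by (simp add: w_def[symmetric] T_def[symmetric])
qed

section \<open>A square perturbed by a bounded rational function of one variable\<close>

lemma bounded_rational_perturbation:
  fixes b0 b1 x :: real
  shows "\<bar>(b0 + b1 * x) / (1 + x^2)\<bar> \<le> \<bar>b0\<bar> + \<bar>b1\<bar>"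
proof -
  have "\<bar>x\<bar> \<le> 1 + x^2" using sum_squares_bound[of "\<bar>x\<bar>" 1] by simp
  then have "\<bar>b1 * x\<bar> \<le> \<bar>b1\<bar> * (1 + x^2)" by (simp add: abs_mult mult_left_mono)
  moreover have "\<bar>b0\<bar> \<le> \<bar>b0\<bar> * (1 + x^2)" by (simp add: mult_le_cancel_left1)
  ultimately have "\<bar>b0 + b1 * x\<bar> \<le> (\<bar>b0\<bar> + \<bar>b1\<bar>) * (1 + x^2)"
    by (simp add: distrib_right)
  then show ?thesis using one_plus_square_pos[of x] by (simp add: abs_divide pos_divide_le_eq)
qed

text \<open>The second derivative of the fraction never falls below \<open>-6 * B\<close>, and
  \<open>3 * B * x^2\<close> adds exactly \<open>6 * B\<close>. This quantifies how far the fraction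
  is from being convex.\<close>

lemma convex_on_rational_perturbation:
  fixes b0 b1 :: real
  defines "B \<equiv> \<bar>b0\<bar> + \<bar>b1\<bar>"
  shows "convex_on UNIV (\<lambda>x. (b0 + b1 * x) / (1 + x^2) + 3 * B * x^2)"
proof (rule f''_ge0_imp_convex)
  fix x :: real
  have nz: "1 + x^2 \<noteq> 0" using one_plus_square_pos[of x] by simp
  show "((\<lambda>x. (b0 + b1 * x) / (1 + x^2) + 3 * B * x^2) has_real_derivative
      (b1 * (1 + x^2) - (b0 + b1 * x) * (2 * x)) / (1 + x^2)^2 + 6 * B * x) (at x)"
    using nz by (auto intro!: derivative_eq_intros simp: power2_eq_square)
  show "((\<lambda>x. (b1 * (1 + x^2) - (b0 + b1 * x) * (2 * x)) / (1 + x^2)^2 + 6 * B * x) has_real_derivative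
      (b0 * (6 * x^2 - 2) + b1 * (2 * x^3 - 6 * x)) / (1 + x^2)^3 + 6 * B) (at x)"
    using nz
    by (auto intro!: derivative_eq_intros) (simp add: divide_simps, algebra)
  define w where "w = 1 + x^2"
  have w: "w \<ge> 1" by (simp add: w_def)
  have w3: "w \<le> w^3" "w^2 \<le> w^3" using w by (auto intro: power_increasing self_le_power)
  have "\<bar>6 * x^2 - 2\<bar> \<le> 6 * w" unfolding w_def by (auto simp: abs_if)
  then have 1: "\<bar>6 * x^2 - 2\<bar> \<le> 6 * w^3" using w3 by linarith
  \<comment> \<open>The cubic is factored as \<open>2 * x * (x^2 - 3)\<close>; the factors are
    bounded by \<open>w\<close> and \<open>3 * w\<close>.\<close>
  have "2 * \<bar>x\<bar> \<le> w" unfolding w_def using sum_squares_bound[of "\<bar>x\<bar>" 1] by simp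
  then have "2 * \<bar>x\<bar> * \<bar>x^2 - 3\<bar> \<le> w * (3 * w)"
    by (intro mult_mono) (auto simp: w_def abs_if)
  then have "\<bar>2 * x^3 - 6 * x\<bar> \<le> 3 * w^2"
    using abs_mult[of "2 * x" "x^2 - 3"]
    by (simp add: power2_eq_square power3_eq_cube algebra_simps)
  then have 2: "\<bar>2 * x^3 - 6 * x\<bar> \<le> 6 * w^3" using w3 w by (smt (verit) zero_le_power)
  have "\<bar>b0 * (6 * x^2 - 2) + b1 * (2 * x^3 - 6 * x)\<bar> \<le> \<bar>b0\<bar> * (6 * w^3) + \<bar>b1\<bar> * (6 * w^3)"
    using mult_left_mono[OF 1, of "\<bar>b0\<bar>"] mult_left_mono[OF 2, of "\<bar>b1\<bar>"]
    by (simp add: abs_mult[symmetric])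
  also have "\<dots> = 6 * B * w^3" by (simp add: B_def algebra_simps)
  finally have "\<bar>(b0 * (6 * x^2 - 2) + b1 * (2 * x^3 - 6 * x)) / w^3\<bar> \<le> 6 * B"
    using w by (simp add: abs_divide divide_le_eq)
  then show "(b0 * (6 * x^2 - 2) + b1 * (2 * x^3 - 6 * x)) / (1 + x^2)^3 + 6 * B \<ge> 0"
    unfolding w_def by (simp only: abs_le_iff) linarith
qed auto

text \<open>Compare the minimizer with \<open>c\<close>, where the square vanishes: the square at
  \<open>a\<close> is paid for by the oscillation of \<open>r\<close>, which is at most
  \<open>2 * B\<close>.\<close>

lemma perturbed_square_minimizer_near:
  fixes r :: "real \<Rightarrow> real"
  assumes "S > 0" "\<And>x. \<bar>r x\<bar> \<le> B" "\<And>b. S * (a - c)^2 + r a \<le> S * (b - c)^2 + r b"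
  shows "(a - c)^2 \<le> 2 * B / S"
proof -
  have "S * (a - c)^2 \<le> 2 * B" using assms(2)[of a] assms(2)[of c] assms(3)[of c] by simp
  then show ?thesis using assms(1) by (simp add: field_simps)
qed

text \<open>Existence: outside a compact interval around \<open>c\<close> the square outweighs the
  oscillation of the fraction. Uniqueness: for \<open>S > 3 * B\<close> the curvature of the square
  dominates the concavity of the fraction, so the sum is strictly convex.\<close>

lemma perturbed_square_unique_minimizer:
  fixes b0 b1 c S :: real
  defines "B \<equiv> \<bar>b0\<bar> + \<bar>b1\<bar>"
  assumes S: "S > 3 * B"
  shows "\<exists>!a. \<forall>b. S * (a - c)^2 + (b0 + b1 * a) / (1 + a^2) \<le> S * (b - c)^2 + (b0 + b1 * b) / (1 + b^2)"
proof -
  define r where "r x = (b0 + b1 * x) / (1 + x^2)" for x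
  define g where "g x = S * (x - c)^2 + r x" for x
  have rB: "\<bar>r x\<bar> \<le> B" for x unfolding r_def B_def by (rule bounded_rational_perturbation)
  have B0: "B \<ge> 0" unfolding B_def by simp
  have Spos: "S > 0" using S B0 by linarith
  \<comment> \<open>With \<open>d >= 1\<close> one has \<open>d^2 >= d\<close>, so
    \<open>S * d^2 >= S * d >= 2 * B\<close> without a square root in the radius.\<close>
  define d where "d = 1 + 2 * B / S"
  have d1: "d \<ge> 1" unfolding d_def using Spos B0 by simp
  have "continuous_on {c - d..c + d} g"
    unfolding g_def r_def by (intro continuous_intros) (metis one_plus_square_pos less_irrefl)
  then obtain a where a: "a \<in> {c - d..c + d}" "\<And>x. x \<in> {c - d..c + d} \<Longrightarrow> g a \<le> g x"
    using continuous_attains_inf[of "{c - d..c + d}" g] d1 by auto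
  have ex: "g a \<le> g b" for b
  proof (cases "b \<in> {c - d..c + d}")
    case False
    then have "\<bar>b - c\<bar> \<ge> d" by (auto simp: abs_if)
    then have "(b - c)^2 \<ge> d^2" using d1 by (metis abs_le_square_iff abs_of_nonneg order_trans zero_le_one)
    moreover have "d \<le> d^2" using d1 by (simp add: self_le_power)
    ultimately have "S * (b - c)^2 \<ge> S * d" using Spos by simp
    moreover have "S * d \<ge> 2 * B" using Spos B0 by (simp add: d_def field_simps)
    ultimately have "g c \<le> g b" using rB[of c] rB[of b] by (simp add: g_def)
    moreover have "g a \<le> g c" using a(2)[of c] d1 by simp
    ultimately show ?thesis by linarith
  qed (use a in auto)
  have uniq: "x = z" if x: "\<And>b. g x \<le> g b" and z: "\<And>b. g z \<le> g b" for x z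
  proof (rule ccontr)
    assume ne: "x \<noteq> z"
    \<comment> \<open>The midpoint of two distinct minimizers beats their average: the square gains
      \<open>S * (x - z)^2 / 4\<close>, while \<open>r\<close> loses at most
      \<open>3 * B * (x - z)^2 / 4\<close>.\<close>
    define m where "m = (x + z) / 2"
    have "convex_on UNIV (\<lambda>x. r x + 3 * B * x^2)"
      unfolding r_def B_def by (rule convex_on_rational_perturbation)
    from convex_onD[OF this, of "1/2" x z]
    have conv: "r m + 3 * B * m^2 \<le> (r x + 3 * B * x^2 + (r z + 3 * B * z^2)) / 2"
      by (simp add: m_def add_divide_distrib)
    have sq: "(S - 3 * B) * (x - z)^2 > 0" using S ne by simp
    have "(S * (x - c)^2 + S * (z - c)^2) / 2 - S * (m - c)^2 = S * (x - z)^2 / 4"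
      unfolding m_def by (simp add: power2_eq_square field_simps)
    moreover have "(3 * B * x^2 + 3 * B * z^2) / 2 - 3 * B * m^2 = 3 * B * (x - z)^2 / 4"
      unfolding m_def by (simp add: power2_eq_square field_simps)
    ultimately have "g x + g z > 2 * g m" using conv sq unfolding g_def left_diff_distrib by argo
    then show False using x[of m] z[of m] by linarith
  qed
  have "\<exists>!a. \<forall>b. g a \<le> g b" using ex uniq by blast
  then show ?thesis unfolding g_def r_def .
qed

text \<open>The whole analysis of the estimator for one fixed path. Probability enters later only
  through the two limit hypotheses \<open>S2\<close> and \<open>ratio\<close>.\<close>

lemma CLS_unique_and_consistent:
  fixes y :: "nat \<Rightarrow> real" and mu \<alpha> :: real and s1 s2 :: nat
  defines "I \<equiv> \<lambda>n. {1..n} - {s1, s1 + 1, s2, s2 + 1}"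
  defines "S2 \<equiv> \<lambda>n. \<Sum>k\<in>I n. (y (k - 1))^2"
  defines "minimizer \<equiv> \<lambda>n p. \<forall>q :: real \<times> real \<times> real.
      Qn mu s1 s2 n y (fst p) (fst (snd p)) (snd (snd p))
        \<le> Qn mu s1 s2 n y (fst q) (fst (snd q)) (snd (snd q))"
  assumes S2: "filterlim S2 at_top sequentially"
    and ratio: "(\<lambda>n. (\<Sum>k\<in>I n. y (k - 1) * (y k - \<alpha> * y (k - 1) - mu)) / S2 n) \<longlonglongrightarrow> 0"
  shows "(\<exists>n0. \<forall>n\<ge>n0. \<exists>!p. minimizer n p)"
    and "(\<lambda>n. fst (CLS_est mu s1 s2 n y)) \<longlonglongrightarrow> \<alpha>"
    and "(\<lambda>n. fst (snd (CLS_est mu s1 s2 n y))) \<longlonglongrightarrow>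
          outlier_profile mu (y (s1 - 1)) (y s1) (y (s1 + 1)) \<alpha>"
    and "(\<lambda>n. snd (snd (CLS_est mu s1 s2 n y))) \<longlonglongrightarrow>
          outlier_profile mu (y (s2 - 1)) (y s2) (y (s2 + 1)) \<alpha>"
proof -
  define q1 q2 where "q1 = y (s1 - 1)" and "q2 = y (s2 - 1)"
  define c1 c2 where "c1 = y (s1 + 1) - mu + q1" and "c2 = y (s2 + 1) - mu + q2"
  define \<tau>1 \<tau>2 where "\<tau>1 = outlier_profile mu q1 (y s1) (y (s1 + 1))"
    and "\<tau>2 = outlier_profile mu q2 (y s2) (y (s2 + 1))"
  \<comment> \<open>Sum of the rational remainders that \<open>outlier_block_eq\<close> leaves in
    the two blocks; they involve only observations around the outliers, so they are the same for all
    \<open>n\<close>.\<close>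
  define b0 b1 where "b0 = c1^2 - mu^2 + (c2^2 - mu^2)" and "b1 = - 2 * c1 * mu - 2 * c2 * mu"
  define r where "r a = (b0 + b1 * a) / (1 + a^2)" for a
  define B where "B = \<bar>b0\<bar> + \<bar>b1\<bar>"
  define S1 where "S1 n = (\<Sum>k\<in>I n. y (k - 1) * (y k - mu))" for n
  define S0 where "S0 n = (\<Sum>k\<in>I n. (y k - mu)^2)" for n
  \<comment> \<open>After profiling, the polynomial part of the objective is
    \<open>S n * a^2 - 2 * a * T n\<close> plus a constant. Completing the square gives the centre
    \<open>c n\<close> and puts \<open>- (T n)^2 / S n\<close> into \<open>K n\<close>.\<close>
  define S where "S n = S2 n + q1^2 + q2^2" for n
  define T where "T n = S1 n - mu * (q1 + q2)" for n
  define c where "c n = T n / S n" for n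
  define K where "K n = S0 n + q1^2 + q2^2 - 2 * q1 * c1 - 2 * q2 * c2 + 2 * mu^2 - (T n)^2 / S n" for n
  define R where "R n a = S n * (a - c n)^2 + r a" for n a
  have decomp: "Qn mu s1 s2 n y a t1 t2
      = R n a + K n + (1 + a^2) * (t1 - \<tau>1 a)^2 + (1 + a^2) * (t2 - \<tau>2 a)^2"
    if "S n > 0" for n a t1 t2
  proof -
    have sum: "(\<Sum>k\<in>I n. (y k - a * y (k - 1) - mu)^2) = S2 n * a^2 - 2 * a * S1 n + S0 n"
      unfolding S2_def S1_def S0_def sum_distrib_left sum_distrib_right sum_subtractf[symmetric] sum.distrib[symmetric]
      by (rule sum.cong) (auto simp: power2_eq_square algebra_simps)
    have sq: "S n * (a - c n)^2 = S n * a^2 - 2 * a * T n + (T n)^2 / S n"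
      using that by (simp add: c_def power2_eq_square field_simps)
    have r: "(c1^2 - mu^2 + (- 2 * c1 * mu) * a) / (1 + a^2) + (c2^2 - mu^2 + (- 2 * c2 * mu) * a) / (1 + a^2) = r a"
      by (simp add: r_def b0_def b1_def add_divide_distrib[symmetric] algebra_simps)
    have I: "{1..n} - {s1, s1 + 1, s2, s2 + 1} = I n" by (simp add: I_def)
    show ?thesis
      unfolding Qn_def I sum outlier_block_eq R_def sq r[symmetric]
        q1_def[symmetric] q2_def[symmetric] c1_def[symmetric] c2_def[symmetric] \<tau>1_def[symmetric] \<tau>2_def[symmetric]
        K_def T_def
      unfolding S_def by (simp add: algebra_simps)
  qed
  have rB: "\<bar>r x\<bar> \<le> B" for x unfolding r_def B_def by (rule bounded_rational_perturbation)
  have B0: "B \<ge> 0" unfolding B_def by simp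
  have S: "filterlim S at_top sequentially"
    unfolding S_def[abs_def]
    by (rule filterlim_at_top_mono[OF S2]) (simp add: add_nonneg_nonneg)
  define good where "good n \<longleftrightarrow> S n > 3 * B" for n
  have ev: "eventually good sequentially"
    using S unfolding filterlim_at_top_dense good_def by blast
  define est where "est n = (THE a. \<forall>b. R n a \<le> R n b)" for n
  have uniq: "\<exists>!a. \<forall>b. R n a \<le> R n b" if "good n" for n
    using perturbed_square_unique_minimizer[of b0 b1 "S n" "c n"] that
    unfolding R_def r_def good_def B_def by blast
  have est: "R n (est n) \<le> R n b" if "good n" for n b
    using theI'[OF uniq[OF that]] unfolding est_def by blast
  have est_eqI: "a = est n" if "good n" "\<And>b. R n a \<le> R n b" for n a
    using uniq[OF that(1)] est[OF that(1)] that(2) by blast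
  \<comment> \<open>The two outlier terms in \<open>decomp\<close> are nonnegative and vanish
    exactly at the profile values, so minimizing over three variables reduces to minimizing
    \<open>R n\<close> over the first.\<close>
  have min_iff: "minimizer n p \<longleftrightarrow> p = (est n, \<tau>1 (est n), \<tau>2 (est n))" if g: "good n" for n p
  proof -
    obtain a t1 t2 where p: "p = (a, t1, t2)" by (cases p)
    have Sp: "S n > 0" using g B0 unfolding good_def by linarith
    note Q = decomp[OF Sp]
    have nn: "0 \<le> (1 + x^2) * (z::real)^2" for x z :: real by (simp add: add_nonneg_nonneg)
    show ?thesis
    proof
      assume m: "minimizer n p"
      have "R n a \<le> R n b" for b
      proof -
        have "R n a + (1 + a^2) * (t1 - \<tau>1 a)^2 + (1 + a^2) * (t2 - \<tau>2 a)^2 \<le> R n b"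
          using m[unfolded minimizer_def p, rule_format, of "(b, \<tau>1 b, \<tau>2 b)"] by (simp add: Q)
        then show ?thesis using nn[of a "t1 - \<tau>1 a"] nn[of a "t2 - \<tau>2 a"] by linarith
      qed
      then have a: "a = est n" by (rule est_eqI[OF g])
      have "(1 + a^2) * (t1 - \<tau>1 a)^2 + (1 + a^2) * (t2 - \<tau>2 a)^2 \<le> 0"
        using m[unfolded minimizer_def p, rule_format, of "(a, \<tau>1 a, \<tau>2 a)"]
        by (simp add: Q)
      then have "(1 + a^2) * (t1 - \<tau>1 a)^2 = 0" "(1 + a^2) * (t2 - \<tau>2 a)^2 = 0"
        using nn[of a "t1 - \<tau>1 a"] nn[of a "t2 - \<tau>2 a"] by linarith+
      then have "t1 = \<tau>1 a" "t2 = \<tau>2 a" using one_plus_square_pos[of a] by auto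
      then show "p = (est n, \<tau>1 (est n), \<tau>2 (est n))" using a p by simp
    next
      assume pe: "p = (est n, \<tau>1 (est n), \<tau>2 (est n))"
      show "minimizer n p"
        unfolding minimizer_def
      proof
        fix q :: "real \<times> real \<times> real"
        obtain b u1 u2 where q: "q = (b, u1, u2)" by (cases q)
        show "Qn mu s1 s2 n y (fst p) (fst (snd p)) (snd (snd p))
          \<le> Qn mu s1 s2 n y (fst q) (fst (snd q)) (snd (snd q))"
          using est[OF g, of b] nn[of b "u1 - \<tau>1 b"] nn[of b "u2 - \<tau>2 b"]
          unfolding q pe fst_conv snd_conv Q diff_self zero_power2 mult_zero_right by linarith
      qed
    qed
  qed
  \<comment> \<open>The description operator is evaluated only for good \<open>n\<close>, where the
    minimizer is unique; the limits below therefore hold via eventual equality.\<close>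
  have CLS: "CLS_est mu s1 s2 n y = (est n, \<tau>1 (est n), \<tau>2 (est n))" if "good n" for n
    unfolding CLS_est_def using min_iff[OF that] unfolding minimizer_def by simp
  show "\<exists>n0. \<forall>n\<ge>n0. \<exists>!p. minimizer n p"
  proof -
    obtain n0 where "\<And>n. n \<ge> n0 \<Longrightarrow> good n" using ev unfolding eventually_sequentially by blast
    then show ?thesis using min_iff by (intro exI[of _ n0]) auto
  qed
  have inv: "(\<lambda>n. x / S n) \<longlonglongrightarrow> 0" for x
    by (rule tendsto_divide_0[OF tendsto_const filterlim_at_top_imp_at_infinity[OF S]])
  \<comment> \<open>\<open>c n\<close> is the given ratio times \<open>S2 n / S n\<close>, plus
    \<open>\<alpha> * S2 n / S n\<close>, minus \<open>mu * (q1 + q2) / S n\<close>; here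
    \<open>S2 n / S n = 1 - (q1^2 + q2^2) / S n\<close> tends to 1.\<close>
  have "(\<lambda>n. (\<Sum>k\<in>I n. y (k - 1) * (y k - \<alpha> * y (k - 1) - mu)) / S2 n * (1 - (q1^2 + q2^2) / S n)
          + (\<alpha> * (1 - (q1^2 + q2^2) / S n) - mu * (q1 + q2) / S n)) \<longlonglongrightarrow> 0 * (1 - 0) + (\<alpha> * (1 - 0) - 0)"
    by (intro tendsto_intros ratio inv)
  moreover have "\<forall>\<^sub>F n in sequentially. (\<Sum>k\<in>I n. y (k - 1) * (y k - \<alpha> * y (k - 1) - mu)) / S2 n * (1 - (q1^2 + q2^2) / S n)
          + (\<alpha> * (1 - (q1^2 + q2^2) / S n) - mu * (q1 + q2) / S n) = c n"
    using S2[unfolded filterlim_at_top_dense, rule_format, of 0]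
  proof eventually_elim
    case (elim n)
    have N: "(\<Sum>k\<in>I n. y (k - 1) * (y k - \<alpha> * y (k - 1) - mu)) = S1 n - \<alpha> * S2 n"
      unfolding S1_def S2_def sum_distrib_left sum_subtractf[symmetric]
      by (rule sum.cong) (auto simp: power2_eq_square algebra_simps)
    have Sp: "S n > 0" using elim unfolding S_def by (simp add: add_pos_nonneg)
    have 1: "1 - (q1^2 + q2^2) / S n = S2 n / S n" using Sp by (simp add: field_simps) (simp add: S_def)
    show ?case unfolding N 1 c_def T_def using Sp elim by (simp add: field_simps)
  qed
  ultimately have c: "c \<longlonglongrightarrow> \<alpha>" using Lim_transform_eventually by fastforce
  have "(\<lambda>n. (est n - c n)^2) \<longlonglongrightarrow> 0"
  proof (rule tendsto_sandwich[OF _ _ tendsto_const inv[of "2 * B"]])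
    show "\<forall>\<^sub>F n in sequentially. (est n - c n)^2 \<le> 2 * B / S n"
      using ev
    proof eventually_elim
      case (elim n)
      then have "S n > 0" using B0 unfolding good_def by linarith
      then show ?case by (rule perturbed_square_minimizer_near[OF _ rB est[OF elim, unfolded R_def]])
    qed
  qed simp
  from tendsto_real_sqrt[OF this] have "(\<lambda>n. est n - c n) \<longlonglongrightarrow> 0"
    by (simp add: tendsto_rabs_zero_iff)
  from tendsto_add[OF this c] have lim: "est \<longlonglongrightarrow> \<alpha>" by simp
  have prof: "(\<lambda>n. outlier_profile mu q u p (est n)) \<longlonglongrightarrow> outlier_profile mu q u p \<alpha>" for q u p
    unfolding outlier_profile_def using one_plus_square_pos[of \<alpha>] by (intro tendsto_intros lim) auto
  have prof1: "(\<lambda>n. \<tau>1 (est n)) \<longlonglongrightarrow> \<tau>1 \<alpha>" and prof2: "(\<lambda>n. \<tau>2 (est n)) \<longlonglongrightarrow> \<tau>2 \<alpha>"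
    unfolding \<tau>1_def \<tau>2_def by (rule prof)+
  show "(\<lambda>n. fst (CLS_est mu s1 s2 n y)) \<longlonglongrightarrow> \<alpha>"
    by (rule Lim_transform_eventually[OF lim]) (use ev in eventually_elim, simp add: CLS)
  show "(\<lambda>n. fst (snd (CLS_est mu s1 s2 n y))) \<longlonglongrightarrow>
          outlier_profile mu (y (s1 - 1)) (y s1) (y (s1 + 1)) \<alpha>"
    unfolding q1_def[symmetric] \<tau>1_def[symmetric]
    by (rule Lim_transform_eventually[OF prof1])
      (use ev in eventually_elim, simp add: CLS)
  show "(\<lambda>n. snd (snd (CLS_est mu s1 s2 n y))) \<longlonglongrightarrow>
          outlier_profile mu (y (s2 - 1)) (y s2) (y (s2 + 1)) \<alpha>"
    unfolding q2_def[symmetric] \<tau>2_def[symmetric]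
    by (rule Lim_transform_eventually[OF prof2])
      (use ev in eventually_elim, simp add: CLS)
qed

subsection \<open>Convergence of square-integrable martingales\<close>

text \<open>Summation by parts trades the terms \<open>u k\<close> for increments of
  \<open>b\<close>, weighted by differences of the convergent partial sums; from some index on these
  differences are small, and the increments of \<open>b\<close> telescope.\<close>

lemma Kronecker_lemma:
  fixes b u :: "nat \<Rightarrow> real"
  assumes b: "mono b" "filterlim b at_top sequentially" "\<And>n. b n > 0"
    and conv: "convergent (\<lambda>n. \<Sum>k<n. u k / b k)"
  shows "(\<lambda>n. (\<Sum>k\<le>n. u k) / b n) \<longlonglongrightarrow> 0"
proof -
  define z where "z n = (\<Sum>k<n. u k / b k)" for n
  have u: "u k = b k * (z (Suc k) - z k)" for k
    using b(3)[of k] by (simp add: z_def)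
  have Cauchy: "Cauchy z" using conv unfolding z_def[abs_def] by (rule convergent_Cauchy)
  show ?thesis
  proof (rule LIMSEQ_I)
    fix e :: real assume e: "e > 0"
    \<comment> \<open>A quarter suffices: the initial block, the remainder of the summation by parts
      and the boundary term each contribute at most \<open>d * b n\<close>.\<close>
    define d where "d = e / 4"
    have d: "d > 0" using e by (simp add: d_def)
    obtain m where m: "\<And>n. n \<ge> m \<Longrightarrow> \<bar>z n - z m\<bar> < d"
      using Cauchy d unfolding Cauchy_def dist_real_def by (metis order_refl)
    \<comment> \<open>Up to sign, the quantity inside the absolute value is the sum over
      \<open>m <= k < m + i\<close> of \<open>(b (Suc k) - b k) * (z (Suc k) - z m)\<close>; it is
      zero for \<open>i = 0\<close>.\<close>
    have abel: "\<bar>(\<Sum>k=m..m + i. u k) - b (m + i) * (z (Suc (m + i)) - z m)\<bar> \<le> d * (b (m + i) - b m)" for i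
    proof (induction i)
      case 0
      then show ?case by (simp add: u)
    next
      case (Suc i)
      let ?n = "m + i"
      have "(\<Sum>k=m..m + Suc i. u k) - b (m + Suc i) * (z (Suc (m + Suc i)) - z m)
         = ((\<Sum>k=m..?n. u k) - b ?n * (z (Suc ?n) - z m)) - (b (Suc ?n) - b ?n) * (z (Suc ?n) - z m)"
        using u[of "Suc ?n"] by (simp add: algebra_simps)
      moreover have "\<bar>(b (Suc ?n) - b ?n) * (z (Suc ?n) - z m)\<bar> \<le> (b (Suc ?n) - b ?n) * d"
        using m[of "Suc ?n"] monoD[OF b(1), of ?n "Suc ?n"] by (simp add: abs_mult mult_left_mono)
      ultimately show ?case using Suc by (simp add: algebra_simps)
    qed
    define C where "C = \<bar>\<Sum>k<m. u k\<bar>"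
    obtain n1 where n1: "\<And>n. n \<ge> n1 \<Longrightarrow> b n > C / d"
      using b(2) unfolding filterlim_at_top_dense eventually_sequentially by meson
    show "\<exists>n0. \<forall>n\<ge>n0. norm ((\<Sum>k\<le>n. u k) / b n - 0) < e"
    proof (intro exI allI impI)
      fix n assume n: "n \<ge> max m n1"
      then obtain i where i: "n = m + i" using le_Suc_ex by (metis max.bounded_iff)
      have "{..n} = {..<m} \<union> {m..n}" using n by auto
      then have "(\<Sum>k\<le>n. u k) = (\<Sum>k<m. u k) + (\<Sum>k=m..n. u k)"
        by (simp add: sum.union_disjoint[symmetric] ivl_disj_int)
      moreover have "\<bar>b n * (z (Suc n) - z m)\<bar> \<le> b n * d"
        using m[of "Suc n"] n b(3)[of n] by (simp add: abs_mult mult_left_mono)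
      ultimately have "\<bar>\<Sum>k\<le>n. u k\<bar> \<le> C + d * (b n - b m) + b n * d"
        using abel[of i] unfolding i C_def by linarith
      also have "\<dots> < d * b n + d * b n + b n * d"
        using n1[of n] n d b(3)[of m] by (simp add: field_simps) (smt (verit) mult_pos_pos)
      also have "\<dots> < e * b n" unfolding d_def using e b(3)[of n] by (simp add: field_simps)
      finally show "norm ((\<Sum>k\<le>n. u k) / b n - 0) < e"
        using b(3)[of n] by (simp add: abs_divide pos_divide_less_eq)
    qed
  qed
qed

lemma integrable_mult_of_square:
  fixes f g :: "'a \<Rightarrow> real"
  assumes [measurable]: "f \<in> borel_measurable M" "g \<in> borel_measurable M"
    and "integrable M (\<lambda>x. (f x)^2)" "integrable M (\<lambda>x. (g x)^2)"
  shows "integrable M (\<lambda>x. f x * g x)"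
proof (rule Bochner_Integration.integrable_bound[OF Bochner_Integration.integrable_add[OF assms(3,4)]])
  have "\<bar>a * b\<bar> \<le> a^2 + b^2" for a b :: real
  proof -
    have "2 * (\<bar>a\<bar> * \<bar>b\<bar>) \<le> a^2 + b^2"
      using sum_squares_bound[of "\<bar>a\<bar>" "\<bar>b\<bar>"] by simp
    moreover have "0 \<le> \<bar>a\<bar> * \<bar>b\<bar>" by simp
    ultimately show ?thesis unfolding abs_mult by linarith
  qed
  then show "AE x in M. norm (f x * g x) \<le> norm ((f x)^2 + (g x)^2)"
    by simp
qed simp

lemma integrable_square_add:
  fixes f g :: "'a \<Rightarrow> real"
  assumes [measurable]: "f \<in> borel_measurable M" "g \<in> borel_measurable M"
    and "integrable M (\<lambda>x. (f x)^2)" "integrable M (\<lambda>x. (g x)^2)"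
  shows "integrable M (\<lambda>x. (f x + g x)^2)"
proof -
  have "integrable M (\<lambda>x. (f x)^2 + (g x)^2 + 2 * (f x * g x))"
    using integrable_mult_of_square[OF assms] assms(3,4) by auto
  moreover have "(f x + g x)^2 = (f x)^2 + (g x)^2 + 2 * (f x * g x)" for x
    by (simp add: power2_sum)
  ultimately show ?thesis by simp
qed

section \<open>Martingale differences: maximal inequality and almost sure convergence\<close>

locale L2_martingale_diff = prob_space +
  fixes F :: "nat \<Rightarrow> 'a measure" and D :: "nat \<Rightarrow> 'a \<Rightarrow> real"
  assumes subalg: "\<And>n. subalgebra M (F n)"
    and filtration: "\<And>n. sets (F n) \<subseteq> sets (F (Suc n))"
    and adapted: "\<And>n. D n \<in> borel_measurable (F (Suc n))"
    and square_integrable: "\<And>n. integrable M (\<lambda>\<omega>. (D n \<omega>)^2)"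
    and cond_exp_0: "\<And>n. AE \<omega> in M. real_cond_exp M (F n) (D n) \<omega> = 0"
begin

lemma D_measurable [measurable]: "D n \<in> borel_measurable M"
  using adapted subalg by (rule measurable_from_subalg[rotated])

lemma F_Suc: "f \<in> borel_measurable (F n) \<Longrightarrow> f \<in> borel_measurable (F (Suc n))"
  by (rule measurable_from_subalg)
    (use subalg[of n] subalg[of "Suc n"] filtration[of n] in \<open>auto simp: subalgebra_def\<close>)

text \<open>The factor \<open>f\<close> can be pulled out of the conditional expectation given
  \<open>F n\<close>, which is zero. Square integrability of both factors makes the product
  integrable.\<close>

lemma orthogonal:
  assumes f: "f \<in> borel_measurable (F n)" "integrable M (\<lambda>\<omega>. (f \<omega>)^2)"
  shows "expectation (\<lambda>\<omega>. f \<omega> * D n \<omega>) = 0"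
proof -
  interpret sigma_finite_subalgebra M "F n"
    by (rule finite_measure_subalgebra_is_sigma_finite)
      (simp add: finite_measure_subalgebra_def finite_measure_axioms finite_measure_subalgebra_axioms_def subalg)
  have fM: "f \<in> borel_measurable M" using measurable_from_subalg[OF subalg f(1)] .
  have "expectation (\<lambda>\<omega>. f \<omega> * D n \<omega>) = expectation (\<lambda>\<omega>. f \<omega> * real_cond_exp M (F n) (D n) \<omega>)"
    using real_cond_exp_intg(2)[OF integrable_mult_of_square[OF fM D_measurable f(2) square_integrable] f(1) D_measurable]
    by simp
  also have "\<dots> = expectation (\<lambda>\<omega>. 0)"
    using cond_exp_0[of n] fM by (intro integral_cong_AE) auto
  finally show ?thesis by simp
qed

text \<open>The martingale restarted at time \<open>m\<close> and frozen once its absolute value reaches \<open>l\<close>: Chebyshev's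
  inequality for the stopped process is the maximal inequality for the original one.\<close>
fun stopped :: "real \<Rightarrow> nat \<Rightarrow> nat \<Rightarrow> 'a \<Rightarrow> real" where
  "stopped l m 0 \<omega> = 0"
| "stopped l m (Suc n) \<omega> = stopped l m n \<omega> + (if \<bar>stopped l m n \<omega>\<bar> < l then D (m + n) \<omega> else 0)"

lemma stopped_measurable: "stopped l m n \<in> borel_measurable (F (m + n))"
proof (induction n)
  case (Suc n)
  have [measurable]: "stopped l m n \<in> borel_measurable (F (Suc (m + n)))"
    "D (m + n) \<in> borel_measurable (F (Suc (m + n)))"
    using F_Suc[OF Suc] adapted by auto
  have "(\<lambda>\<omega>. stopped l m n \<omega> + (if \<bar>stopped l m n \<omega>\<bar> < l then D (m + n) \<omega> else 0)) \<in> borel_measurable (F (Suc (m + n)))"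
    by measurable
  then show ?case by (simp add: stopped.simps(2)[abs_def])
qed (simp add: stopped.simps(1)[abs_def])

text \<open>The decision to continue depends on \<open>F (m + n)\<close> only, so the cross term of
  the squared step is orthogonal to \<open>D (m + n)\<close>, and freezing can only shrink the
  squared increment.\<close>

lemma stopped_second_moment:
  "integrable M (\<lambda>\<omega>. (stopped l m n \<omega>)^2) \<and>
   expectation (\<lambda>\<omega>. (stopped l m n \<omega>)^2) \<le> (\<Sum>k<n. expectation (\<lambda>\<omega>. (D (m + k) \<omega>)^2))"
proof (induction n)
  case (Suc n)
  let ?Z = "stopped l m n"
  define f where "f \<omega> = ?Z \<omega> * of_bool (\<bar>?Z \<omega>\<bar> < l)" for \<omega>
  define g where "g \<omega> = of_bool (\<bar>?Z \<omega>\<bar> < l) * D (m + n) \<omega>" for \<omega>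
  have ZF[measurable]: "?Z \<in> borel_measurable (F (m + n))" by (rule stopped_measurable)
  have fF: "f \<in> borel_measurable (F (m + n))" unfolding f_def[abs_def] by measurable
  have ZM[measurable]: "?Z \<in> borel_measurable M" using measurable_from_subalg[OF subalg ZF] .
  have fM[measurable]: "f \<in> borel_measurable M" using measurable_from_subalg[OF subalg fF] .
  have gM[measurable]: "g \<in> borel_measurable M" unfolding g_def[abs_def] by measurable
  have Z2: "integrable M (\<lambda>\<omega>. (?Z \<omega>)^2)" using Suc by simp
  have f2: "integrable M (\<lambda>\<omega>. (f \<omega>)^2)"
    by (rule Bochner_Integration.integrable_bound[OF Z2]) (auto simp: f_def)
  have g2: "integrable M (\<lambda>\<omega>. (g \<omega>)^2)"
    by (rule Bochner_Integration.integrable_bound[OF square_integrable[of "m + n"]]) (auto simp: g_def)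
  have gle: "expectation (\<lambda>\<omega>. (g \<omega>)^2) \<le> expectation (\<lambda>\<omega>. (D (m + n) \<omega>)^2)"
    by (rule integral_mono[OF g2 square_integrable]) (auto simp: g_def)
  have fD: "integrable M (\<lambda>\<omega>. f \<omega> * D (m + n) \<omega>)"
    by (rule integrable_mult_of_square[OF fM D_measurable f2 square_integrable])
  have step: "(stopped l m (Suc n) \<omega>)^2 = (?Z \<omega>)^2 + (g \<omega>)^2 + 2 * (f \<omega> * D (m + n) \<omega>)" for \<omega>
    by (simp add: f_def g_def power2_sum algebra_simps)
  have "expectation (\<lambda>\<omega>. (stopped l m (Suc n) \<omega>)^2)
      = expectation (\<lambda>\<omega>. (?Z \<omega>)^2) + expectation (\<lambda>\<omega>. (g \<omega>)^2)"
    unfolding step using Z2 g2 fD orthogonal[OF fF f2] by simp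
  moreover have "integrable M (\<lambda>\<omega>. (stopped l m (Suc n) \<omega>)^2)"
    unfolding step using Z2 g2 fD by simp
  ultimately show ?case using gle Suc by simp
qed simp

text \<open>Either no partial sum has reached level \<open>l\<close> and nothing has been frozen, or
  the process is frozen at a value of size at least \<open>l\<close> and stays there.\<close>

lemma stopped_hit:
  "(\<forall>i\<le>n. \<bar>\<Sum>k<i. D (m + k) \<omega>\<bar> < l) \<and> stopped l m n \<omega> = (\<Sum>k<n. D (m + k) \<omega>) \<or> l \<le> \<bar>stopped l m n \<omega>\<bar>"
proof (induction n)
  case (Suc n)
  then show ?case by (auto simp: le_Suc_eq not_le)
qed auto

lemma maximal_inequality:
  assumes l: "l > 0"
  shows "prob {\<omega>\<in>space M. \<exists>i\<le>n. l \<le> \<bar>\<Sum>k<i. D (m + k) \<omega>\<bar>}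
    \<le> (\<Sum>k<n. expectation (\<lambda>\<omega>. (D (m + k) \<omega>)^2)) / l^2"
proof -
  have ZM[measurable]: "stopped l m n \<in> borel_measurable M"
    using measurable_from_subalg[OF subalg stopped_measurable] .
  have "prob {\<omega>\<in>space M. \<exists>i\<le>n. l \<le> \<bar>\<Sum>k<i. D (m + k) \<omega>\<bar>} \<le> prob {\<omega>\<in>space M. l \<le> \<bar>stopped l m n \<omega>\<bar>}"
  proof (rule finite_measure_mono)
    show "{\<omega>\<in>space M. \<exists>i\<le>n. l \<le> \<bar>\<Sum>k<i. D (m + k) \<omega>\<bar>} \<subseteq> {\<omega>\<in>space M. l \<le> \<bar>stopped l m n \<omega>\<bar>}"
      using stopped_hit[of n m _ l] by (auto simp: not_less[symmetric])
  qed measurable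
  also have "\<dots> = prob {\<omega>\<in>space M. l^2 \<le> (stopped l m n \<omega>)^2}"
    using l by (simp add: abs_le_square_iff[of l, symmetric])
  also have "\<dots> \<le> expectation (\<lambda>\<omega>. (stopped l m n \<omega>)^2) / l^2"
    using l stopped_second_moment[of l m n] by (intro integral_Markov_inequality_measure[where A="{}"]) auto
  also have "\<dots> \<le> (\<Sum>k<n. expectation (\<lambda>\<omega>. (D (m + k) \<omega>)^2)) / l^2"
    using stopped_second_moment[of l m n] by (intro divide_right_mono) auto
  finally show ?thesis .
qed

text \<open>The maximal inequality, applied to the martingale restarted at \<open>m\<close>, bounds
  the probability of a later oscillation of size \<open>l\<close> by a tail of the series. Hence
  almost surely some restart stays within \<open>l\<close>; the countably many levels
  \<open>1 / Suc j\<close> give the Cauchy property.\<close>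

theorem AE_convergent:
  assumes sm: "summable (\<lambda>n. expectation (\<lambda>\<omega>. (D n \<omega>)^2))"
  shows "AE \<omega> in M. convergent (\<lambda>n. \<Sum>k<n. D k \<omega>)"
proof -
  define a where "a n = expectation (\<lambda>\<omega>. (D n \<omega>)^2)" for n
  have a: "summable a" "\<And>n. a n \<ge> 0" using sm by (auto simp: a_def[abs_def])
  define H where "H l m \<omega> \<longleftrightarrow> (\<exists>i. l \<le> \<bar>\<Sum>k<i. D (m + k) \<omega>\<bar>)" for l m \<omega>
  have tail: "prob {\<omega>\<in>space M. H l m \<omega>} \<le> (\<Sum>k. a (k + m)) / l^2" if l: "l > 0" for l m
  proof -
    define A where "A n = {\<omega>\<in>space M. \<exists>i\<le>n. l \<le> \<bar>\<Sum>k<i. D (m + k) \<omega>\<bar>}" for n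
    \<comment> \<open>The finite-horizon events increase to the event \<open>H l m\<close>, so the
      bound passes to an infinite horizon.\<close>
    have "(\<lambda>n. prob (A n)) \<longlonglongrightarrow> prob (\<Union>n. A n)"
    proof (rule finite_Lim_measure_incseq)
      show "range A \<subseteq> events" unfolding A_def by auto
      show "incseq A" unfolding A_def incseq_def by (auto intro: order_trans)
    qed
    moreover have "prob (A n) \<le> (\<Sum>k. a (k + m)) / l^2" for n
    proof -
      have "prob (A n) \<le> (\<Sum>k<n. a (k + m)) / l^2"
        using maximal_inequality[OF l, of n m] unfolding A_def a_def by (simp add: add.commute)
      also have "\<dots> \<le> (\<Sum>k. a (k + m)) / l^2"
        using a by (intro divide_right_mono sum_le_suminf) (auto simp: summable_iff_shift)
      finally show ?thesis .
    qed
    ultimately have "prob (\<Union>n. A n) \<le> (\<Sum>k. a (k + m)) / l^2"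
      by (intro LIMSEQ_le_const2[where X="\<lambda>n. prob (A n)"]) auto
    also have "(\<Union>n. A n) = {\<omega>\<in>space M. H l m \<omega>}" unfolding A_def H_def by auto
    finally show ?thesis .
  qed
  have HM[measurable]: "Measurable.pred M (H l m)" for l m unfolding H_def by measurable
  have "AE \<omega> in M. \<exists>m. \<not> H l m \<omega>" if l: "l > 0" for l
  proof -
    have "prob {\<omega>\<in>space M. \<forall>m. H l m \<omega>} \<le> (\<Sum>k. a (k + m)) / l^2" for m
      by (rule order_trans[OF finite_measure_mono tail[OF l, of m]]) auto
    moreover have "(\<lambda>m. (\<Sum>k. a (k + m)) / l^2) \<longlonglongrightarrow> 0"
      using tendsto_divide[OF suminf_exist_split2[OF a(1)] tendsto_const[of "l^2"]] l by simp
    ultimately have "prob {\<omega>\<in>space M. \<forall>m. H l m \<omega>} \<le> 0"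
      by (intro LIMSEQ_le_const) auto
    then have "prob {\<omega>\<in>space M. \<forall>m. H l m \<omega>} = 0" by (simp add: measure_le_0_iff)
    then show ?thesis by (subst (asm) prob_eq_0) auto
  qed
  then have "AE \<omega> in M. \<forall>j::nat. \<exists>m. \<not> H (1 / Suc j) m \<omega>"
    by (subst AE_all_countable) auto
  then show ?thesis
  proof eventually_elim
    case (elim \<omega>)
    define S where "S n = (\<Sum>k<n. D k \<omega>)" for n
    have diff: "S (m + i) - S m = (\<Sum>k<i. D (m + k) \<omega>)" for m i
      by (induction i) (auto simp: S_def)
    have "Cauchy S"
    proof (rule metric_CauchyI)
      fix e :: real assume "e > 0"
      then obtain j where j: "1 / real (Suc j) < e / 2" using nat_approx_posE[of "e / 2"] by auto
      obtain m where m: "\<And>i. \<bar>S (m + i) - S m\<bar> < 1 / real (Suc j)"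
        using elim unfolding H_def diff by (meson not_le)
      have "\<bar>S p - S m\<bar> < e / 2" if "p \<ge> m" for p
        using m[of "p - m"] j that by simp
      then have "dist (S p) (S q) < e" if "p \<ge> m" "q \<ge> m" for p q
        using that unfolding dist_real_def by (smt (verit) field_sum_of_halves)
      then show "\<exists>M. \<forall>m\<ge>M. \<forall>n\<ge>M. dist (S m) (S n) < e" by blast
    qed
    then show ?case unfolding S_def by (simp add: Cauchy_convergent_iff)
  qed
qed

end

subsection \<open>The INAR(1) process\<close>

text \<open>Independence makes the joint law a product, so Fubini applies. This serves as
  conditioning on the past: \<open>P\<close> is held fixed while only \<open>G\<close> is
  averaged.\<close>

lemma (in prob_space) expectation_freezing:
  fixes \<phi> :: "'b \<times> 'b \<Rightarrow> real"
  assumes ind: "indep_var S P T G" and \<phi>[measurable]: "\<phi> \<in> borel_measurable (S \<Otimes>\<^sub>M T)"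
    and int: "integrable M (\<lambda>\<omega>. \<phi> (P \<omega>, G \<omega>))"
  shows "expectation (\<lambda>\<omega>. \<phi> (P \<omega>, G \<omega>)) = expectation (\<lambda>\<omega>. expectation (\<lambda>\<omega>'. \<phi> (P \<omega>, G \<omega>')))"
proof -
  have P[measurable]: "P \<in> measurable M S" and G[measurable]: "G \<in> measurable M T"
    and joint: "distr M S P \<Otimes>\<^sub>M distr M T G = distr M (S \<Otimes>\<^sub>M T) (\<lambda>x. (P x, G x))"
    using ind unfolding indep_var_distribution_eq by auto
  interpret P: prob_space "distr M S P" by (rule prob_space_distr) simp
  interpret G: prob_space "distr M T G" by (rule prob_space_distr) simp
  interpret PG: pair_sigma_finite "distr M S P" "distr M T G" ..
  have "integrable (distr M S P \<Otimes>\<^sub>M distr M T G) \<phi>"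
    unfolding joint using int by (subst integrable_distr_eq) auto
  from PG.integral_fst'[OF this]
  have "expectation (\<lambda>\<omega>. \<phi> (P \<omega>, G \<omega>)) = (\<integral>x. (\<integral>y. \<phi> (x, y) \<partial>distr M T G) \<partial>distr M S P)"
    unfolding joint by (simp add: integral_distr)
  also have "\<dots> = expectation (\<lambda>\<omega>. \<integral>y. \<phi> (P \<omega>, y) \<partial>distr M T G)"
    by (rule integral_distr) measurable
  also have "\<dots> = expectation (\<lambda>\<omega>. expectation (\<lambda>\<omega>'. \<phi> (P \<omega>, G \<omega>')))"
  proof (rule Bochner_Integration.integral_cong[OF refl])
    fix \<omega> assume "\<omega> \<in> space M"
    then have [measurable]: "P \<omega> \<in> space S" using measurable_space[OF P] by blast
    show "(\<integral>y. \<phi> (P \<omega>, y) \<partial>distr M T G) = expectation (\<lambda>\<omega>'. \<phi> (P \<omega>, G \<omega>'))"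
      by (rule integral_distr) measurable
  qed
  finally show ?thesis .
qed

lemma (in prob_space) integrable_of_square_integrable:
  fixes f :: "'a \<Rightarrow> real"
  assumes [measurable]: "f \<in> borel_measurable M" and "integrable M (\<lambda>\<omega>. (f \<omega>)^2)"
  shows "integrable M f"
  using integrable_mult_of_square[OF assms(1) borel_measurable_const assms(2), of 1] by simp

lemma measurable_nat_add:
  fixes f g :: "'a \<Rightarrow> nat"
  assumes "f \<in> measurable N (count_space UNIV)" "g \<in> measurable N (count_space UNIV)"
  shows "(\<lambda>x. f x + g x) \<in> measurable N (count_space UNIV)"
  by (rule measurable_compose_countable[of "\<lambda>i x. i + g x", OF _ assms(1)])
    (rule measurable_compose[OF assms(2)], simp)

lemma measurable_nat_sum:
  fixes f :: "'i \<Rightarrow> 'a \<Rightarrow> nat"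
  assumes "finite J" "\<And>i. i \<in> J \<Longrightarrow> f i \<in> measurable N (count_space UNIV)"
  shows "(\<lambda>x. \<Sum>i\<in>J. f i x) \<in> measurable N (count_space UNIV)"
  using assms by (induction J rule: finite_induct) (auto intro!: measurable_nat_add)

text \<open>A deterministic bound for the conditional variances of the martingale: each term is at
  most a difference of consecutive values of 4 over the square root of the normalizer.\<close>

lemma normalized_cubes_sum_bounded:
  fixes x :: "nat \<Rightarrow> real"
  assumes x: "\<And>k. x k \<ge> 0"
  shows "(\<Sum>k<n. (x k / (1 + (\<Sum>i\<le>k. (x i)^2)))^2 * (x k + 1)) \<le> 4"
proof -
  define c where "c n = 1 + (\<Sum>i<n. (x i)^2)" for n
  have c1: "c n \<ge> 1" for n unfolding c_def by (simp add: sum_nonneg)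
  \<comment> \<open>Since \<open>c n\<close> sums strictly below \<open>n\<close>, the normalizer of
    term \<open>k\<close> is \<open>c (Suc k)\<close>. The bound is 0 at \<open>n = 0\<close>
    because \<open>c 0 = 1\<close>.\<close>
  have "(\<Sum>k<n. (x k / c (Suc k))^2 * (x k + 1)) \<le> 4 - 4 / sqrt (c n)"
  proof (induction n)
    case (Suc n)
    define u w where "u = sqrt (c n)" and "w = sqrt (c (Suc n))"
    have u: "u \<ge> 1" "u^2 = c n" unfolding u_def using c1[of n] by simp_all
    have w: "w \<ge> 1" "w^2 = c (Suc n)" unfolding w_def using c1[of "Suc n"] by simp_all
    have x2: "(x n)^2 = w^2 - u^2" unfolding u w by (simp add: c_def)
    have uw: "u \<le> w" unfolding u_def w_def by (simp add: c_def)
    have xw: "x n \<le> w" by (rule power2_le_imp_le) (use x2 w in auto)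
    have "(x n / c (Suc n))^2 * (x n + 1) = (w^2 - u^2) * (x n + 1) / w^4"
      by (simp add: power_divide x2 w(2)[symmetric])
    \<comment> \<open>Both \<open>x n\<close> and 1 are at most \<open>w\<close>. Later
      \<open>w + u\<close> is replaced by \<open>2 * w\<close>, and one factor \<open>w\<close> of
      the denominator by \<open>u\<close>, to reach the telescoping form.\<close>
    also have "\<dots> \<le> (w^2 - u^2) * (2 * w) / w^4"
      using xw w(1) uw u(1) by (intro divide_right_mono mult_left_mono) (auto intro: power_mono)
    also have "\<dots> = (w - u) * (2 * (w + u)) / w^3"
      using w(1) by (simp add: power2_eq_square power3_eq_cube power4_eq_xxxx field_simps)
    also have "\<dots> \<le> (w - u) * (4 * w) / w^3"
      using uw w(1) by (intro divide_right_mono mult_left_mono) auto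
    also have "\<dots> = (w - u) * 4 / (w * w)"
      using w(1) by (simp add: power3_eq_cube)
    also have "\<dots> \<le> (w - u) * 4 / (u * w)"
      using uw w(1) u(1) by (intro divide_left_mono) auto
    also have "\<dots> = 4 / u - 4 / w"
      using u(1) w(1) by (simp add: field_simps)
    finally show ?case using Suc by (simp add: u_def w_def)
  qed (simp add: c_def)
  also have "\<dots> \<le> 4" using c1[of n] by simp
  finally show ?thesis unfolding c_def by (simp add: lessThan_Suc_atMost)
qed

lemma filterlim_sum_at_top_of_frequently_ge_1:
  fixes f :: "nat \<Rightarrow> real"
  assumes nn: "\<And>k. f k \<ge> 0" and inf: "\<And>m. \<exists>k>m. f k \<ge> 1"
  shows "filterlim (\<lambda>n. \<Sum>k\<le>n. f k) at_top sequentially"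
proof -
  have mono: "(\<Sum>k\<le>n. f k) \<le> (\<Sum>k\<le>m. f k)" if "n \<le> m" for n m
    using that nn by (intro sum_mono2) auto
  have ex: "\<exists>n. real N \<le> (\<Sum>k\<le>n. f k)" for N
  proof (induction N)
    case 0
    then show ?case using nn by (auto intro!: exI[of _ 0])
  next
    case (Suc N)
    then obtain n where n: "real N \<le> (\<Sum>k\<le>n. f k)" by blast
    obtain k where k: "k > n" "f k \<ge> 1" using inf by blast
    have "(\<Sum>k\<le>n. f k) \<le> (\<Sum>k\<le>k - 1. f k)" using k by (intro mono) simp
    moreover have "(\<Sum>k\<le>k. f k) = (\<Sum>k\<le>k - 1. f k) + f k"
      using k(1) by (cases k) auto
    ultimately show ?case using n k(2) by (intro exI[of _ k]) simp
  qed
  show ?thesis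
    unfolding filterlim_at_top eventually_sequentially
  proof
    fix Z :: real
    obtain N where "Z \<le> real N" using real_arch_simple by blast
    moreover obtain n where "real N \<le> (\<Sum>k\<le>n. f k)" using ex by blast
    ultimately show "\<exists>N. \<forall>n\<ge>N. Z \<le> (\<Sum>k\<le>n. f k)" using mono order_trans by metis
  qed
qed

text \<open>The sum type indexes the initial value, the innovations and the thinning variables as
  one family, so a single \<open>indep_vars\<close> expresses all the independence
  assumptions.\<close>

locale INAR1 = prob_space M for M :: "'a measure" +
  fixes X eps :: "nat \<Rightarrow> 'a \<Rightarrow> nat" and xi :: "nat \<Rightarrow> nat \<Rightarrow> 'a \<Rightarrow> nat" and \<alpha> :: real
  assumes alpha: "0 < \<alpha>" "\<alpha> < 1"
    and indep: "indep_vars (\<lambda>_. count_space UNIV)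
        (case_sum (\<lambda>_. X 0) (case_sum eps (\<lambda>(k, j). xi k j)))
        ({Inl ()} \<union> Inr ` (Inl ` {1..} \<union> Inr ` ({1..} \<times> {1..})))"
    and eps_id: "\<forall>k\<ge>1. distr M (count_space UNIV) (eps k) = distr M (count_space UNIV) (eps 1)"
    and eps_sq: "integrable M (\<lambda>\<omega>. (real (eps 1 \<omega>))^2)"
    and eps_nz: "prob {\<omega> \<in> space M. eps 1 \<omega> \<noteq> 0} > 0"
    and xi_bern: "\<forall>k\<ge>1. \<forall>j\<ge>1. (\<forall>\<omega>\<in>space M. xi k j \<omega> \<in> {0, 1})
        \<and> prob {\<omega> \<in> space M. xi k j \<omega> = 1} = \<alpha>"
    and X0_sq: "integrable M (\<lambda>\<omega>. (real (X 0 \<omega>))^2)"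
    and recur: "\<forall>k\<ge>1. \<forall>\<omega>\<in>space M. X k \<omega> = (\<Sum>j\<in>{1..X (k-1) \<omega>}. xi k j \<omega>) + eps k \<omega>"
begin

section \<open>Driving variables: past, fresh part, and the path as a function of them\<close>

definition "\<mu> = expectation (\<lambda>\<omega>. real (eps 1 \<omega>))"

definition "\<sigma>2 = expectation (\<lambda>\<omega>. (real (eps 1 \<omega>) - \<mu>)^2)"

definition V :: "unit + nat + nat \<times> nat \<Rightarrow> 'a \<Rightarrow> nat" where
  "V = case_sum (\<lambda>_. X 0) (case_sum eps (\<lambda>(k, j). xi k j))"

definition past :: "nat \<Rightarrow> (unit + nat + nat \<times> nat) set" where
  "past k = {Inl ()} \<union> Inr ` (Inl ` {1..k} \<union> Inr ` ({1..k} \<times> {1..}))"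

definition fresh :: "nat \<Rightarrow> (unit + nat + nat \<times> nat) set" where
  "fresh k = Inr ` (Inl ` {Suc k} \<union> Inr ` ({Suc k} \<times> {1..}))"

abbreviation "coords J \<equiv> PiM J (\<lambda>_. count_space (UNIV :: nat set))"

definition "hist k \<omega> = restrict (\<lambda>i. V i \<omega>) (past k)"

definition "news k \<omega> = restrict (\<lambda>i. V i \<omega>) (fresh k)"

text \<open>Index \<open>0\<close> addresses the innovation of the step from \<open>k\<close> to \<open>Suc k\<close>, index \<open>i \<ge> 1\<close> the \<open>i\<close>-th
  thinning variable, so that all centred increments of a step form one family.\<close>
definition idx :: "nat \<Rightarrow> nat \<Rightarrow> unit + nat + nat \<times> nat" where
  "idx k i = (if i = 0 then Inr (Inl (Suc k)) else Inr (Inr (Suc k, i)))"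

definition "center i = (if i = (0::nat) then \<mu> else \<alpha>)"

text \<open>The number \<open>m\<close> of thinning variables is a free parameter: moments are
  computed for deterministic \<open>m\<close>, and the random value of the path is inserted
  afterwards.\<close>

definition noise :: "nat \<Rightarrow> nat \<Rightarrow> (unit + nat + nat \<times> nat \<Rightarrow> nat) \<Rightarrow> real" where
  "noise k m f = (\<Sum>i\<le>m. real (f (idx k i)) - center i)"

text \<open>The process as a function on the coordinate space, so that \<open>X i\<close> becomes a
  measurable function of the history alone.\<close>

fun path :: "nat \<Rightarrow> (unit + nat + nat \<times> nat \<Rightarrow> nat) \<Rightarrow> nat" where
  "path 0 f = f (Inl ())"
| "path (Suc k) f = (\<Sum>j\<in>{1..path k f}. f (Inr (Inr (Suc k, j)))) + f (Inr (Inl (Suc k)))"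

abbreviation "resid k \<omega> \<equiv> real (X (Suc k) \<omega>) - \<alpha> * real (X k \<omega>) - \<mu>"

lemma V_simps [simp]: "V (Inl ()) = X 0" "V (Inr (Inl k)) = eps k" "V (Inr (Inr (k, j))) = xi k j"
  by (simp_all add: V_def)

abbreviation all_idx :: "(unit + nat + nat \<times> nat) set" where
  "all_idx \<equiv> {Inl ()} \<union> Inr ` (Inl ` {1..} \<union> Inr ` ({1..} \<times> {1..}))"

lemma V_indep: "indep_vars (\<lambda>_. count_space UNIV) V all_idx"
  using indep unfolding V_def .

lemma past_subset: "past k \<subseteq> all_idx" by (auto simp: past_def)
lemma fresh_subset: "fresh k \<subseteq> all_idx" by (auto simp: fresh_def)
lemma past_fresh_disjoint: "past k \<inter> fresh k = {}" by (auto simp: past_def fresh_def)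
lemma idx_fresh: "idx k i \<in> fresh k" by (auto simp: idx_def fresh_def)
lemma idx_inj: "idx k i = idx k j \<longleftrightarrow> i = j" by (auto simp: idx_def)

lemma V_measurable: "i \<in> all_idx \<Longrightarrow> V i \<in> measurable M (count_space UNIV)"
  using V_indep unfolding indep_vars_def by auto

lemma hist_news_indep: "indep_var (coords (past k)) (hist k) (coords (fresh k)) (news k)"
  unfolding hist_def[abs_def] news_def[abs_def]
  by (rule indep_var_restrict[OF V_indep past_fresh_disjoint past_subset fresh_subset])

lemma hist_measurable [measurable]: "hist k \<in> measurable M (coords (past k))"
  using hist_news_indep unfolding indep_var_distribution_eq by blast

lemma path_hist:
  assumes "\<omega> \<in> space M" "i \<le> k"
  shows "path i (hist k \<omega>) = X i \<omega>"
  using assms(2)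
proof (induction i)
  case 0
  then show ?case by (simp add: hist_def past_def)
next
  case (Suc i)
  have "hist k \<omega> (Inr (Inl (Suc i))) = eps (Suc i) \<omega>"
    using Suc by (auto simp: hist_def past_def)
  moreover have "hist k \<omega> (Inr (Inr (Suc i, j))) = xi (Suc i) j \<omega>" if "j \<ge> 1" for j
    using Suc that by (auto simp: hist_def past_def)
  ultimately show ?case
    using recur[rule_format, of "Suc i", OF _ assms(1)] Suc by simp
qed

lemma path_measurable:
  "i \<le> k \<Longrightarrow> path i \<in> measurable (coords (past k)) (count_space UNIV)"
proof (induction i)
  case 0
  have "Inl () \<in> past k" by (simp add: past_def)
  then show ?case by (simp add: path.simps(1)[abs_def])
next
  case (Suc i)
  have e: "Inr (Inl (Suc i)) \<in> past k" using Suc by (auto simp: past_def)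
  have x: "Inr (Inr (Suc i, j)) \<in> past k" if "j \<ge> 1" for j using Suc that by (auto simp: past_def)
  have "(\<lambda>f. \<Sum>j\<in>{1..m}. f (Inr (Inr (Suc i, j)))) \<in> measurable (coords (past k)) (count_space UNIV)" for m
    using x by (intro measurable_nat_sum) (auto intro!: measurable_component_singleton)
  \<comment> \<open>The upper limit of the sum is itself random, but it takes countably many values,
    so measurability for each fixed \<open>m\<close> suffices.\<close>
  from measurable_compose_countable[of "\<lambda>m f. \<Sum>j\<in>{1..m}. f (Inr (Inr (Suc i, j)))", OF this]
  have "(\<lambda>f. \<Sum>j\<in>{1..path i f}. f (Inr (Inr (Suc i, j)))) \<in> measurable (coords (past k)) (count_space UNIV)"
    using Suc by simp
  then have "(\<lambda>f. (\<Sum>j\<in>{1..path i f}. f (Inr (Inr (Suc i, j)))) + f (Inr (Inl (Suc i))))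
      \<in> measurable (coords (past k)) (count_space UNIV)"
    using e by (intro measurable_nat_add) (auto intro!: measurable_component_singleton)
  then show ?case by (simp add: path.simps(2)[abs_def])
qed

lemma X_measurable [measurable]: "X k \<in> measurable M (count_space UNIV)"
proof -
  have "(\<lambda>\<omega>. path k (hist k \<omega>)) \<in> measurable M (count_space UNIV)"
    by (rule measurable_compose[OF hist_measurable path_measurable]) simp
  then show ?thesis
    by (subst measurable_cong[where g="\<lambda>\<omega>. path k (hist k \<omega>)"]) (simp_all add: path_hist)
qed

lemma noise_measurable: "noise k m \<in> borel_measurable (coords (fresh k))"
proof -
  have "(\<lambda>f. real (f (idx k i))) \<in> borel_measurable (coords (fresh k))" for i
    by (rule measurable_compose[OF measurable_component_singleton[OF idx_fresh]]) simp
  then show ?thesis unfolding noise_def[abs_def] by (intro borel_measurable_sum borel_measurable_diff) auto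
qed

text \<open>The term \<open>\<alpha> * X k\<close> splits into one \<open>\<alpha>\<close> per
  thinning variable, which centres each of them separately.\<close>

lemma noise_news_path:
  assumes "\<omega> \<in> space M"
  shows "noise k (path k (hist k \<omega>)) (news k \<omega>) = resid k \<omega>"
proof -
  have V: "news k \<omega> (idx k i) = V (idx k i) \<omega>" for i using idx_fresh by (simp add: news_def)
  have "{..m} = insert 0 {1..m}" for m :: nat by auto
  then have "noise k m (news k \<omega>) = real (eps (Suc k) \<omega>) - \<mu> + (\<Sum>j\<in>{1..m}. real (xi (Suc k) j \<omega>) - \<alpha>)" for m
    unfolding noise_def V by (simp add: center_def idx_def)
  then show ?thesis
    using recur[rule_format, of "Suc k", OF _ assms]
    by (simp add: path_hist[OF assms] sum_subtractf)
qed

section \<open>Moments of the increments, the noise and the process\<close>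

lemma distr_eps:
  fixes f :: "nat \<Rightarrow> real"
  assumes "k \<ge> 1"
  shows "expectation (\<lambda>\<omega>. f (eps k \<omega>)) = expectation (\<lambda>\<omega>. f (eps 1 \<omega>))"
    and "integrable M (\<lambda>\<omega>. f (eps k \<omega>)) \<longleftrightarrow> integrable M (\<lambda>\<omega>. f (eps 1 \<omega>))"
proof -
  have m: "eps k \<in> measurable M (count_space UNIV)" if "k \<ge> 1" for k
    using V_measurable[of "Inr (Inl k)"] that by simp
  have d: "distr M (count_space UNIV) (eps k) = distr M (count_space UNIV) (eps 1)"
    using eps_id assms by blast
  show "expectation (\<lambda>\<omega>. f (eps k \<omega>)) = expectation (\<lambda>\<omega>. f (eps 1 \<omega>))"
    using integral_distr[OF m[OF assms], of f] integral_distr[OF m[of 1], of f] d by simp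
  show "integrable M (\<lambda>\<omega>. f (eps k \<omega>)) \<longleftrightarrow> integrable M (\<lambda>\<omega>. f (eps 1 \<omega>))"
    using integrable_distr_eq[OF m[OF assms], of f] integrable_distr_eq[OF m[of 1], of f] d by simp
qed

abbreviation "increment k i \<omega> \<equiv> real (V (idx k i) \<omega>) - center i"

lemma idx_all: "idx k i \<in> all_idx"
  using idx_fresh fresh_subset by blast

lemma V_idx_measurable [measurable]: "V (idx k i) \<in> measurable M (count_space UNIV)"
  by (rule V_measurable[OF idx_all])

lemma V_idx_square_integrable: "integrable M (\<lambda>\<omega>. (real (V (idx k i) \<omega>))^2)"
proof (cases "i = 0")
  case True
  then show ?thesis using distr_eps(2)[of "Suc k" "\<lambda>n. (real n)^2"] eps_sq by (simp add: idx_def)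
next
  case False
  have "AE \<omega> in M. norm ((real (V (idx k i) \<omega>))^2) \<le> 1"
    using False xi_bern[rule_format, of "Suc k" i] by (intro AE_I2) (force simp: idx_def)
  then show ?thesis by (intro integrable_const_bound) auto
qed

lemma V_idx_integrable: "integrable M (\<lambda>\<omega>. real (V (idx k i) \<omega>))"
  by (rule integrable_of_square_integrable[OF _ V_idx_square_integrable]) measurable

lemma increment_integrable: "integrable M (increment k i)"
  using V_idx_integrable by simp

lemma increment_square_integrable: "integrable M (\<lambda>\<omega>. (increment k i \<omega>)^2)"
  using integrable_square_add[of "\<lambda>\<omega>. real (V (idx k i) \<omega>)" M "\<lambda>_. - center i"] V_idx_square_integrable
  by simp

lemma xi_indicator:
  assumes "\<omega> \<in> space M" "i \<noteq> 0"
  shows "real (V (idx k i) \<omega>) = indicator {\<omega> \<in> space M. xi (Suc k) i \<omega> = 1} \<omega>"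
  using assms xi_bern[rule_format, of "Suc k" i] by (force simp: idx_def indicator_def)

lemma expectation_V_idx: "expectation (\<lambda>\<omega>. real (V (idx k i) \<omega>)) = center i"
proof (cases "i = 0")
  case True
  then show ?thesis using distr_eps(1)[of "Suc k" real] by (simp add: idx_def center_def \<mu>_def)
next
  case False
  have "expectation (\<lambda>\<omega>. real (V (idx k i) \<omega>))
      = expectation (indicator {\<omega> \<in> space M. xi (Suc k) i \<omega> = 1})"
    using xi_indicator False by (intro Bochner_Integration.integral_cong) auto
  also have "\<dots> = prob {\<omega> \<in> space M. xi (Suc k) i \<omega> = 1}"
    by simp (rule arg_cong[where f=prob], auto)
  also have "\<dots> = \<alpha>"
    using False xi_bern[rule_format, of "Suc k" i] by simp
  finally show ?thesis using False by (simp add: center_def)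
qed

lemma expectation_increment: "expectation (increment k i) = 0"
  using expectation_V_idx V_idx_integrable by (simp add: prob_space)

lemma increment_second_moment:
  "expectation (\<lambda>\<omega>. (increment k i \<omega>)^2) = (if i = 0 then \<sigma>2 else \<alpha> * (1 - \<alpha>))"
proof (cases "i = 0")
  case True
  then show ?thesis
    using distr_eps(1)[of "Suc k" "\<lambda>n. (real n - \<mu>)^2"] by (simp add: idx_def center_def \<sigma>2_def)
next
  case False
  \<comment> \<open>A variable with values 0 and 1 equals its square, so the squared increment is
    affine in it.\<close>
  have "expectation (\<lambda>\<omega>. (increment k i \<omega>)^2)
      = expectation (\<lambda>\<omega>. (1 - 2 * \<alpha>) * real (V (idx k i) \<omega>) + \<alpha>^2)"
    using xi_indicator[OF _ False, of _ k] False
    by (intro Bochner_Integration.integral_cong)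
      (auto simp: center_def indicator_def power2_eq_square algebra_simps)
  also have "\<dots> = (1 - 2 * \<alpha>) * \<alpha> + \<alpha>^2"
    using V_idx_integrable expectation_V_idx[of k i] False by (simp add: prob_space center_def)
  finally show ?thesis using False by (simp add: power2_eq_square algebra_simps)
qed

lemma increment_uncorrelated:
  assumes "i \<noteq> j"
  shows "expectation (\<lambda>\<omega>. increment k i \<omega> * increment k j \<omega>) = 0"
proof -
  let ?p = "\<lambda>i f. real (f (idx k i)) - center i"
  have m: "?p i \<in> borel_measurable (coords {idx k i})" for i
    by (rule borel_measurable_diff)
      (auto intro!: measurable_compose[OF measurable_component_singleton])
  have "indep_var borel (?p i \<circ> (\<lambda>\<omega>. restrict (\<lambda>a. V a \<omega>) {idx k i}))
                  borel (?p j \<circ> (\<lambda>\<omega>. restrict (\<lambda>a. V a \<omega>) {idx k j}))"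
    using assms idx_all[of k i] idx_all[of k j]
    by (intro indep_var_compose[OF indep_var_restrict[OF V_indep] m m]) (auto simp: idx_inj)
  then have "indep_var borel (increment k i) borel (increment k j)"
    by (simp add: comp_def)
  from indep_var_lebesgue_integral[OF this increment_integrable increment_integrable]
  show ?thesis using expectation_increment by simp
qed

lemma noise_news: "noise k m (news k \<omega>) = (\<Sum>i\<le>m. increment k i \<omega>)"
  using idx_fresh by (simp add: noise_def news_def)

lemma expectation_noise: "expectation (\<lambda>\<omega>. noise k m (news k \<omega>)) = 0"
  unfolding noise_news using expectation_increment increment_integrable
  by (subst Bochner_Integration.integral_sum) auto

text \<open>Only the diagonal survives: the innovation variance and \<open>m\<close> Bernoulli
  variances. The growth is linear in \<open>m\<close>, which is what makes the normalized variances
  summable.\<close>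

lemma noise_second_moment:
  "expectation (\<lambda>\<omega>. (noise k m (news k \<omega>))^2) = \<sigma>2 + real m * (\<alpha> * (1 - \<alpha>))"
proof -
  have int: "integrable M (\<lambda>\<omega>. increment k i \<omega> * increment k j \<omega>)" for i j
    by (rule integrable_mult_of_square[OF _ _ increment_square_integrable increment_square_integrable]) measurable
  have "expectation (\<lambda>\<omega>. (noise k m (news k \<omega>))^2)
      = expectation (\<lambda>\<omega>. \<Sum>i\<le>m. \<Sum>j\<le>m. increment k i \<omega> * increment k j \<omega>)"
    unfolding noise_news power2_eq_square sum_product ..
  also have "\<dots> = (\<Sum>i\<le>m. \<Sum>j\<le>m. expectation (\<lambda>\<omega>. increment k i \<omega> * increment k j \<omega>))"
    using int by (subst Bochner_Integration.integral_sum) (auto intro!: sum.cong Bochner_Integration.integral_sum)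
  also have "\<dots> = (\<Sum>i\<le>m. \<Sum>j\<le>m. if j = i then expectation (\<lambda>\<omega>. (increment k i \<omega>)^2) else 0)"
    using increment_uncorrelated by (intro sum.cong) (auto simp: power2_eq_square)
  also have "\<dots> = (\<Sum>i\<le>m. if i = 0 then \<sigma>2 else \<alpha> * (1 - \<alpha>))"
    by (simp add: increment_second_moment)
  also have "\<dots> = \<sigma>2 + real m * (\<alpha> * (1 - \<alpha>))"
    by (induction m) (auto simp: algebra_simps)
  finally show ?thesis .
qed

text \<open>Thinning never increases a value, so \<open>X (Suc k)\<close> is at most
  \<open>X k\<close> plus the innovation.\<close>

lemma X_square_integrable: "integrable M (\<lambda>\<omega>. (real (X k \<omega>))^2)"
proof (induction k)
  case (Suc k)
  have "integrable M (\<lambda>\<omega>. (real (X k \<omega>) + real (V (idx k 0) \<omega>))^2)"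
    by (rule integrable_square_add[OF _ _ Suc V_idx_square_integrable]) measurable
  moreover have "X (Suc k) \<omega> \<le> X k \<omega> + V (idx k 0) \<omega>" if "\<omega> \<in> space M" for \<omega>
  proof -
    have "(\<Sum>j\<in>{1..X k \<omega>}. xi (Suc k) j \<omega>) \<le> (\<Sum>j\<in>{1..X k \<omega>}. 1)"
      using xi_bern that by (intro sum_mono) (force dest: spec[of _ "Suc k"])
    then show ?thesis using recur[rule_format, of "Suc k", OF _ that] by (simp add: idx_def)
  qed
  then have "AE \<omega> in M. norm ((real (X (Suc k) \<omega>))^2) \<le> norm ((real (X k \<omega>) + real (V (idx k 0) \<omega>))^2)"
    by (intro AE_I2) (simp add: power_mono flip: of_nat_add)
  ultimately show ?case
    by (intro Bochner_Integration.integrable_bound[OF _ _ \<open>AE \<omega> in M. _ \<omega>\<close>]) auto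
qed (rule X0_sq)

lemma resid_square_integrable: "integrable M (\<lambda>\<omega>. (resid k \<omega>)^2)"
proof -
  have "integrable M (\<lambda>\<omega>. (real (X (Suc k) \<omega>) + (- \<alpha>) * real (X k \<omega>))^2)"
    using X_square_integrable by (intro integrable_square_add) (auto simp: power_mult_distrib)
  from integrable_square_add[OF _ _ this, of "\<lambda>_. - \<mu>"]
  show ?thesis by simp
qed

section \<open>The normalized martingale differences and their filtration\<close>

definition "energy k \<omega> = 1 + (\<Sum>i\<le>k. (real (X i \<omega>))^2)"

text \<open>The ratio of \<open>X k\<close> to \<open>energy k\<close> written on the coordinate
  space, so that it is frozen together with the history.\<close>

definition "weight k p = real (path k p) / (1 + (\<Sum>i\<le>k. (real (path i p))^2))"

lemma energy_ge_1: "energy k \<omega> \<ge> 1"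
  by (simp add: energy_def sum_nonneg)

lemma weight_hist: "\<omega> \<in> space M \<Longrightarrow> weight k (hist k \<omega>) = real (X k \<omega>) / energy k \<omega>"
  by (simp add: weight_def energy_def path_hist)

lemma weight_measurable: "weight k \<in> borel_measurable (coords (past k))"
proof -
  have "(\<lambda>p. real (path i p)) \<in> borel_measurable (coords (past k))" if "i \<le> k" for i
    by (rule measurable_compose[OF path_measurable[OF that]]) simp
  then show ?thesis unfolding weight_def[abs_def]
    by (intro borel_measurable_divide borel_measurable_add borel_measurable_sum borel_measurable_power) auto
qed

text \<open>A natural number is at most its square, which is one of the summands of the
  denominator.\<close>

lemma weight_bounds: "0 \<le> weight k p" "weight k p \<le> 1"
proof -
  let ?s = "\<Sum>i\<le>k. (real (path i p))^2"
  have s: "?s \<ge> 0" by (simp add: sum_nonneg)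
  have "path k p \<le> (path k p)^2" by (cases "path k p") (simp_all add: power2_eq_square)
  then have "real (path k p) \<le> (real (path k p))^2" by (metis of_nat_le_iff of_nat_power)
  also have "\<dots> \<le> ?s" by (rule member_le_sum) auto
  finally show "weight k p \<le> 1" using s by (simp add: weight_def)
  show "0 \<le> weight k p" using s by (simp add: weight_def)
qed

definition "D k \<omega> = real (X k \<omega>) / energy k \<omega> * resid k \<omega>"

lemma D_measurable [measurable]: "D k \<in> borel_measurable M"
  unfolding D_def[abs_def] energy_def[abs_def] by measurable

lemma D_eq: "\<omega> \<in> space M \<Longrightarrow> D k \<omega> = weight k (hist k \<omega>) * noise k (path k (hist k \<omega>)) (news k \<omega>)"
  by (simp add: D_def weight_hist noise_news_path)

lemma D_square_integrable: "integrable M (\<lambda>\<omega>. (D k \<omega>)^2)"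
proof (rule Bochner_Integration.integrable_bound[OF resid_square_integrable])
  show "AE \<omega> in M. norm ((D k \<omega>)^2) \<le> norm ((resid k \<omega>)^2)"
  proof (rule AE_I2)
    fix \<omega> assume "\<omega> \<in> space M"
    then have "(D k \<omega>)^2 = (weight k (hist k \<omega>))^2 * (resid k \<omega>)^2"
      by (simp add: D_def weight_hist power_mult_distrib power_divide)
    also have "\<dots> \<le> 1 * (resid k \<omega>)^2"
      using weight_bounds[of k "hist k \<omega>"] by (intro mult_right_mono) (auto intro: power_le_one)
    finally show "norm ((D k \<omega>)^2) \<le> norm ((resid k \<omega>)^2)" by simp
  qed
qed measurable

lemma noise_path_measurable:
  "(\<lambda>z. noise k (path k (fst z)) (snd z)) \<in> borel_measurable (coords (past k) \<Otimes>\<^sub>M coords (fresh k))"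
  by (rule measurable_compose_countable[of "\<lambda>m z. noise k m (snd z)"])
    (auto intro: measurable_compose[OF measurable_snd noise_measurable]
      measurable_compose[OF measurable_fst path_measurable])

text \<open>Once the history is frozen, weight and number of thinning variables are constants and
  the noise has mean zero. This is the martingale property tested on events of the past.\<close>

lemma expectation_D_hist:
  assumes B: "B \<in> sets (coords (past k))"
  shows "expectation (\<lambda>\<omega>. indicator B (hist k \<omega>) * D k \<omega>) = 0"
proof -
  define \<phi> where "\<phi> z = indicator B (fst z) * (weight k (fst z) * noise k (path k (fst z)) (snd z))" for z
  note [measurable] = noise_path_measurable weight_measurable B
  have \<phi>: "\<phi> \<in> borel_measurable (coords (past k) \<Otimes>\<^sub>M coords (fresh k))"
    unfolding \<phi>_def[abs_def] by measurable
  have eq: "\<phi> (hist k \<omega>, news k \<omega>) = indicator B (hist k \<omega>) * D k \<omega>" if "\<omega> \<in> space M" for \<omega>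
    using that by (simp add: \<phi>_def D_eq)
  have "integrable M (\<lambda>\<omega>. indicator B (hist k \<omega>) * D k \<omega>)"
    by (rule Bochner_Integration.integrable_bound[OF integrable_of_square_integrable[OF D_measurable D_square_integrable, of k]])
      (auto simp: indicator_def)
  then have "integrable M (\<lambda>\<omega>. \<phi> (hist k \<omega>, news k \<omega>))"
    by (simp add: eq cong: Bochner_Integration.integrable_cong)
  from expectation_freezing[OF hist_news_indep \<phi> this]
  have "expectation (\<lambda>\<omega>. \<phi> (hist k \<omega>, news k \<omega>)) = 0"
    by (simp add: \<phi>_def expectation_noise)
  then show ?thesis by (simp add: eq cong: Bochner_Integration.integral_cong)
qed

lemma D_second_moment:
  "expectation (\<lambda>\<omega>. (D k \<omega>)^2)
    = expectation (\<lambda>\<omega>. (weight k (hist k \<omega>))^2 * (\<sigma>2 + real (X k \<omega>) * (\<alpha> * (1 - \<alpha>))))"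
proof -
  define \<phi> where "\<phi> z = (weight k (fst z))^2 * (noise k (path k (fst z)) (snd z))^2" for z
  note [measurable] = noise_path_measurable weight_measurable
  have \<phi>: "\<phi> \<in> borel_measurable (coords (past k) \<Otimes>\<^sub>M coords (fresh k))"
    unfolding \<phi>_def[abs_def] by measurable
  have eq: "\<phi> (hist k \<omega>, news k \<omega>) = (D k \<omega>)^2" if "\<omega> \<in> space M" for \<omega>
    using that by (simp add: \<phi>_def D_eq power_mult_distrib)
  have "integrable M (\<lambda>\<omega>. \<phi> (hist k \<omega>, news k \<omega>))"
    using D_square_integrable by (simp add: eq cong: Bochner_Integration.integrable_cong)
  from expectation_freezing[OF hist_news_indep \<phi> this]
  have "expectation (\<lambda>\<omega>. \<phi> (hist k \<omega>, news k \<omega>))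
      = expectation (\<lambda>\<omega>. (weight k (hist k \<omega>))^2 * (\<sigma>2 + real (path k (hist k \<omega>)) * (\<alpha> * (1 - \<alpha>))))"
    by (simp add: \<phi>_def noise_second_moment)
  then show ?thesis by (simp add: eq path_hist cong: Bochner_Integration.integral_cong)
qed

text \<open>The conditional variance factor is at most \<open>(\<sigma>2 + 1) * (X k + 1)\<close>.
  Then \<open>normalized_cubes_sum_bounded\<close> bounds the sum path by path, before the
  expectation is taken, by a constant independent of \<open>n\<close>.\<close>

lemma summable_D_second_moment: "summable (\<lambda>k. expectation (\<lambda>\<omega>. (D k \<omega>)^2))"
proof (rule summableI_nonneg_bounded)
  fix n
  have \<sigma>: "\<sigma>2 \<ge> 0" unfolding \<sigma>2_def by simp
  let ?g = "\<lambda>k \<omega>. (weight k (hist k \<omega>))^2 * (real (X k \<omega>) + 1)"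
  note [measurable] = weight_measurable
  have g: "integrable M (?g k)" for k
  proof (rule Bochner_Integration.integrable_bound)
    show "integrable M (\<lambda>\<omega>. real (X k \<omega>) + 1)"
      using integrable_of_square_integrable[OF _ X_square_integrable[of k]] by simp
    show "AE \<omega> in M. norm (?g k \<omega>) \<le> norm (real (X k \<omega>) + 1)"
    proof (rule AE_I2)
      fix \<omega>
      have "(weight k (hist k \<omega>))^2 * (real (X k \<omega>) + 1) \<le> 1 * (real (X k \<omega>) + 1)"
        using weight_bounds[of k "hist k \<omega>"] by (intro mult_right_mono) (auto intro: power_le_one)
      then show "norm (?g k \<omega>) \<le> norm (real (X k \<omega>) + 1)" by simp
    qed
  qed measurable
  have le: "expectation (\<lambda>\<omega>. (D k \<omega>)^2) \<le> (\<sigma>2 + 1) * expectation (?g k)" for k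
  proof -
    have "expectation (\<lambda>\<omega>. (D k \<omega>)^2) \<le> expectation (\<lambda>\<omega>. (\<sigma>2 + 1) * ?g k \<omega>)"
      unfolding D_second_moment
    proof (rule integral_mono')
      show "integrable M (\<lambda>\<omega>. (\<sigma>2 + 1) * ?g k \<omega>)" using g by simp
      fix \<omega>
      have a: "\<alpha> * (1 - \<alpha>) \<le> 1" using alpha mult_mono[of \<alpha> 1 "1 - \<alpha>" 1] by simp
      have "\<sigma>2 + real (X k \<omega>) * (\<alpha> * (1 - \<alpha>)) \<le> \<sigma>2 + real (X k \<omega>) * 1"
        using a by (intro add_left_mono mult_left_mono) auto
      also have "\<dots> \<le> (\<sigma>2 + 1) * (real (X k \<omega>) + 1)" using \<sigma> by (simp add: algebra_simps)
      finally have "(weight k (hist k \<omega>))^2 * (\<sigma>2 + real (X k \<omega>) * (\<alpha> * (1 - \<alpha>)))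
         \<le> (weight k (hist k \<omega>))^2 * ((\<sigma>2 + 1) * (real (X k \<omega>) + 1))"
        by (intro mult_left_mono) auto
      then show "(weight k (hist k \<omega>))^2 * (\<sigma>2 + real (X k \<omega>) * (\<alpha> * (1 - \<alpha>))) \<le> (\<sigma>2 + 1) * ?g k \<omega>"
        by (simp add: mult_ac)
      show "0 \<le> (\<sigma>2 + 1) * ?g k \<omega>" using \<sigma> by simp
    qed
    then show ?thesis by simp
  qed
  have "(\<Sum>k<n. expectation (\<lambda>\<omega>. (D k \<omega>)^2)) \<le> (\<sigma>2 + 1) * (\<Sum>k<n. expectation (?g k))"
    unfolding sum_distrib_left by (rule sum_mono[OF le])
  also have "(\<Sum>k<n. expectation (?g k)) = expectation (\<lambda>\<omega>. \<Sum>k<n. ?g k \<omega>)"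
    using g by (subst Bochner_Integration.integral_sum) auto
  also have "\<dots> \<le> expectation (\<lambda>\<omega>. 4)"
  proof (rule integral_mono)
    show "integrable M (\<lambda>\<omega>. \<Sum>k<n. ?g k \<omega>)" using g by (rule Bochner_Integration.integrable_sum)
    show "(\<Sum>k<n. ?g k \<omega>) \<le> 4" if "\<omega> \<in> space M" for \<omega>
      using normalized_cubes_sum_bounded[of "\<lambda>k. real (X k \<omega>)" n] that
      by (simp add: weight_hist energy_def)
  qed simp
  also have "\<dots> = 4" by (simp add: prob_space)
  finally show "(\<Sum>k<n. expectation (\<lambda>\<omega>. (D k \<omega>)^2)) \<le> (\<sigma>2 + 1) * 4" using \<sigma> by simp
qed simp

text \<open>Generated by all driving variables up to time \<open>k\<close> rather than by the path
  alone; every event is a preimage under \<open>hist k\<close>, the form that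
  \<open>expectation_D_hist\<close> handles.\<close>

definition "Fil k = vimage_algebra (space M) (hist k) (coords (past k))"

lemma hist_Fil: "hist k \<in> measurable (Fil k) (coords (past k))"
  unfolding Fil_def using measurable_space[OF hist_measurable]
  by (intro measurable_vimage_algebra1) auto

lemma subalgebra_Fil: "subalgebra M (Fil k)"
proof -
  have "sets (Fil k) \<subseteq> sets M"
    unfolding Fil_def using hist_measurable by (intro sets_image_in_sets) auto
  then show ?thesis by (simp add: subalgebra_def Fil_def)
qed

lemma hist_Fil_mono: "j \<le> k \<Longrightarrow> hist j \<in> measurable (Fil k) (coords (past j))"
proof -
  assume "j \<le> k"
  then have sub: "past j \<subseteq> past k" by (auto simp: past_def)
  have "(\<lambda>\<omega>. restrict (hist k \<omega>) (past j)) \<in> measurable (Fil k) (coords (past j))"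
    by (rule measurable_compose[OF hist_Fil measurable_restrict_subset[OF sub]])
  moreover have "restrict (hist k \<omega>) (past j) = hist j \<omega>" for \<omega>
    using sub by (auto simp: hist_def fun_eq_iff)
  ultimately show ?thesis by simp
qed

lemma X_Fil: "j \<le> k \<Longrightarrow> X j \<in> measurable (Fil k) (count_space UNIV)"
proof -
  assume "j \<le> k"
  then have "(\<lambda>\<omega>. path j (hist k \<omega>)) \<in> measurable (Fil k) (count_space UNIV)"
    by (intro measurable_compose[OF hist_Fil path_measurable])
  then show ?thesis
    by (subst measurable_cong[where g="\<lambda>\<omega>. path j (hist k \<omega>)"]) (simp_all add: path_hist Fil_def \<open>j \<le> k\<close>)
qed

sublocale L2_martingale_diff M Fil D
proof
  fix n
  show "subalgebra M (Fil n)" by (rule subalgebra_Fil)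
  show "sets (Fil n) \<subseteq> sets (Fil (Suc n))"
    unfolding Fil_def[of n] using hist_Fil_mono[of n "Suc n"]
    by (intro sets_image_in_sets) (auto simp: Fil_def)
  have X: "(\<lambda>\<omega>. real (X j \<omega>)) \<in> borel_measurable (Fil (Suc n))" if "j \<le> Suc n" for j
    by (rule measurable_compose[OF X_Fil[OF that]]) simp
  show "D n \<in> borel_measurable (Fil (Suc n))"
    unfolding D_def[abs_def] energy_def
    using X by (intro borel_measurable_times borel_measurable_divide borel_measurable_add
        borel_measurable_sum borel_measurable_power borel_measurable_diff) auto
  show "integrable M (\<lambda>\<omega>. (D n \<omega>)^2)" by (rule D_square_integrable)
  interpret sigma_finite_subalgebra M "Fil n"
    by (rule finite_measure_subalgebra_is_sigma_finite)
      (simp add: finite_measure_subalgebra_def finite_measure_axioms finite_measure_subalgebra_axioms_def subalgebra_Fil)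
  show "AE \<omega> in M. real_cond_exp M (Fil n) (D n) \<omega> = 0"
  \<comment> \<open>The zero function is the conditional expectation as soon as \<open>D n\<close>
    integrates to zero over every event of \<open>Fil n\<close>.\<close>
  proof (rule real_cond_exp_charact)
    fix A assume "A \<in> sets (Fil n)"
    then obtain B where B: "B \<in> sets (coords (past n))" "A = hist n -` B \<inter> space M"
      unfolding Fil_def using measurable_space[OF hist_measurable[of n]]
      by (subst (asm) sets_vimage_algebra2) auto
    have "(\<integral>\<omega>\<in>A. D n \<omega> \<partial>M) = expectation (\<lambda>\<omega>. indicator B (hist n \<omega>) * D n \<omega>)"
      unfolding set_lebesgue_integral_def B(2)
      by (intro Bochner_Integration.integral_cong) (auto simp: indicator_def)
    then show "(\<integral>\<omega>\<in>A. D n \<omega> \<partial>M) = (\<integral>\<omega>\<in>A. 0 \<partial>M)"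
      using expectation_D_hist[OF B(1)] by (simp add: set_lebesgue_integral_def)
  qed (auto intro: integrable_of_square_integrable D_square_integrable)
qed

section \<open>Divergence of the energy and negligibility of the weighted residuals\<close>

lemma AE_eps_frequently_nonzero: "AE \<omega> in M. \<forall>m. \<exists>k>m. eps k \<omega> \<noteq> 0"
proof -
  have em: "eps k \<in> measurable M (count_space UNIV)" if "k \<ge> 1" for k
    using V_measurable[of "Inr (Inl k)"] that by simp
  note [measurable] = em
  define p where "p = prob {\<omega>\<in>space M. eps 1 \<omega> = 0}"
  have "p = 1 - prob {\<omega>\<in>space M. eps 1 \<omega> \<noteq> 0}"
    unfolding p_def using em[of 1] by (subst prob_compl[symmetric]) (auto intro!: arg_cong[where f=prob])
  then have p: "0 \<le> p" "p < 1" using eps_nz by (auto simp: p_def)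
  have pk: "prob (eps k -` {0} \<inter> space M) = p" if "k \<ge> 1" for k
  proof -
    have "prob (eps k -` {0} \<inter> space M) = measure (distr M (count_space UNIV) (eps k)) {0}"
      using em[OF that] by (simp add: measure_distr)
    also have "\<dots> = measure (distr M (count_space UNIV) (eps 1)) {0}"
      using eps_id that by metis
    also have "\<dots> = p"
      using em[of 1] by (simp add: measure_distr p_def) (rule arg_cong[where f=prob], auto)
    finally show ?thesis .
  qed
  have zero: "prob {\<omega>\<in>space M. \<forall>k>m. eps k \<omega> = 0} = 0" for m
  proof -
    \<comment> \<open>By independence \<open>N + 1\<close> consecutive innovations all vanish with
      probability \<open>p ^ Suc N\<close>, which tends to 0 since \<open>p < 1\<close>.\<close>
    have "prob {\<omega>\<in>space M. \<forall>k>m. eps k \<omega> = 0} \<le> p ^ Suc N" for N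
    proof -
      let ?J = "(\<lambda>k. Inr (Inl k)) ` {m + 1..m + Suc N} :: (unit + nat + nat \<times> nat) set"
      have Jsub: "?J \<subseteq> all_idx" by auto
      have "prob (\<Inter>i\<in>?J. V i -` {0} \<inter> space M) = (\<Prod>i\<in>?J. prob (V i -` {0} \<inter> space M))"
        by (rule indep_varsD[OF V_indep _ _ Jsub, where A="\<lambda>_. {0}"]) auto
      also have "\<dots> = (\<Prod>k\<in>{m + 1..m + Suc N}. prob (eps k -` {0} \<inter> space M))"
        by (subst prod.reindex) (auto simp: inj_on_def)
      also have "\<dots> = p ^ Suc N" by (simp add: pk)
      finally have "prob (\<Inter>i\<in>?J. V i -` {0} \<inter> space M) = p ^ Suc N" .
      moreover have "prob {\<omega>\<in>space M. \<forall>k>m. eps k \<omega> = 0} \<le> prob (\<Inter>i\<in>?J. V i -` {0} \<inter> space M)"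
      proof (rule finite_measure_mono)
        show "(\<Inter>i\<in>?J. V i -` {0} \<inter> space M) \<in> events"
          using Jsub by (intro sets.finite_INT) (auto intro!: measurable_sets[OF em])
      qed auto
      ultimately show ?thesis by simp
    qed
    moreover have "(\<lambda>N. p ^ Suc N) \<longlonglongrightarrow> 0"
      using p by (intro LIMSEQ_Suc LIMSEQ_power_zero) auto
    ultimately have "prob {\<omega>\<in>space M. \<forall>k>m. eps k \<omega> = 0} \<le> 0"
      by (intro LIMSEQ_le_const) auto
    then show ?thesis by (simp add: measure_le_0_iff)
  qed
  have "AE \<omega> in M. \<not> (\<forall>k>m. eps k \<omega> = 0)" for m
  proof -
    have "{\<omega>\<in>space M. \<forall>k>m. eps k \<omega> = 0} = (\<Inter>k\<in>{m<..}. eps k -` {0} \<inter> space M)" by auto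
    also have "\<dots> \<in> events"
      by (intro sets.countable_INT') (auto intro!: measurable_sets[OF em])
    finally show ?thesis using zero[of m] by (subst (asm) prob_eq_0) auto
  qed
  then show ?thesis by (subst AE_all_countable) auto
qed

text \<open>A nonzero innovation forces \<open>X k >= 1\<close>, so almost surely infinitely many
  summands are at least 1.\<close>

lemma AE_energy_at_top: "AE \<omega> in M. filterlim (\<lambda>n. energy n \<omega>) at_top sequentially"
  using AE_eps_frequently_nonzero AE_space
proof eventually_elim
  case (elim \<omega>)
  have "filterlim (\<lambda>n. \<Sum>i\<le>n. (real (X i \<omega>))^2) at_top sequentially"
  proof (rule filterlim_sum_at_top_of_frequently_ge_1)
    fix m
    obtain k where k: "k > m" "eps k \<omega> \<noteq> 0" using elim by blast
    then have "X k \<omega> \<ge> 1" using recur[rule_format, of k \<omega>] elim by auto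
    then have "(real (X k \<omega>))^2 \<ge> 1" by (simp add: one_le_power)
    then show "\<exists>k>m. 1 \<le> (real (X k \<omega>))^2" using k by blast
  qed simp
  then show ?case
    unfolding energy_def by (rule filterlim_at_top_mono) simp
qed

lemma AE_weighted_residuals:
  "AE \<omega> in M. (\<lambda>n. (\<Sum>k\<le>n. real (X k \<omega>) * resid k \<omega>) / energy n \<omega>) \<longlonglongrightarrow> 0"
  using AE_energy_at_top AE_convergent[OF summable_D_second_moment]
proof eventually_elim
  case (elim \<omega>)
  show ?case
  proof (rule Kronecker_lemma)
    show "mono (\<lambda>n. energy n \<omega>)"
      unfolding energy_def by (intro monoI add_left_mono sum_mono2) auto
    show "0 < energy n \<omega>" for n using energy_ge_1[of n \<omega>] by linarith
    show "convergent (\<lambda>n. \<Sum>k<n. real (X k \<omega>) * resid k \<omega> / energy k \<omega>)"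
      using elim(2) by (simp add: D_def)
  qed (rule elim(1))
qed

section \<open>Transfer from the clean process to the observations with outliers\<close>

lemma CLS_consistent:
  fixes s1 s2 \<theta>1 \<theta>2 :: nat
  assumes s: "1 \<le> s1" "s1 + 1 < s2"
  defines "Y \<equiv> Yobs X s1 s2 \<theta>1 \<theta>2"
  shows "AE \<omega> in M.
      (\<exists>n0. \<forall>n\<ge>n0. \<exists>!p :: real \<times> real \<times> real. \<forall>q :: real \<times> real \<times> real.
          Qn \<mu> s1 s2 n (\<lambda>k. Y k \<omega>) (fst p) (fst (snd p)) (snd (snd p))
            \<le> Qn \<mu> s1 s2 n (\<lambda>k. Y k \<omega>) (fst q) (fst (snd q)) (snd (snd q)))
    \<and> (\<lambda>n. fst (CLS_est \<mu> s1 s2 n (\<lambda>k. Y k \<omega>))) \<longlonglongrightarrow> \<alpha>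
    \<and> (\<lambda>n. fst (snd (CLS_est \<mu> s1 s2 n (\<lambda>k. Y k \<omega>)))) \<longlonglongrightarrow>
        outlier_profile \<mu> (Y (s1-1) \<omega>) (Y s1 \<omega>) (Y (s1+1) \<omega>) \<alpha>
    \<and> (\<lambda>n. snd (snd (CLS_est \<mu> s1 s2 n (\<lambda>k. Y k \<omega>)))) \<longlonglongrightarrow>
        outlier_profile \<mu> (Y (s2-1) \<omega>) (Y s2 \<omega>) (Y (s2+1) \<omega>) \<alpha>"
  using AE_energy_at_top AE_weighted_residuals
proof eventually_elim
  case (elim \<omega>)
  let ?y = "\<lambda>k. Y k \<omega>"
  \<comment> \<open>An outlier at time \<open>s\<close> enters the summands \<open>k = s\<close> and
    \<open>k = s + 1\<close> only; off \<open>E\<close> both \<open>Y k\<close> and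
    \<open>Y (k - 1)\<close> agree with the process.\<close>
  define E where "E = {s1, s1 + 1, s2, s2 + 1}"
  define e c where "e = (\<Sum>k\<in>E. (real (X (k - 1) \<omega>))^2)"
    and "c = (\<Sum>k\<in>E. real (X (k - 1) \<omega>) * resid (k - 1) \<omega>)"
  define U where "U n = (\<Sum>k\<le>n. real (X k \<omega>) * resid k \<omega>)" for n
  \<comment> \<open>Summands at \<open>k\<close> involve time \<open>k - 1\<close>, so horizon
    \<open>Suc n\<close> matches sums up to \<open>n\<close>. The condition \<open>n >= s2\<close>
    puts all of \<open>E\<close> inside the range, and removing it costs a constant.\<close>
  have trim: "(\<Sum>k\<in>{1..Suc n} - E. g (k - 1)) = (\<Sum>k\<le>n. g k) - (\<Sum>k\<in>E. g (k - 1))"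
    if "n \<ge> s2" for n and g :: "nat \<Rightarrow> real"
  proof -
    have "E \<subseteq> {1..Suc n}" using that s by (auto simp: E_def)
    then have "(\<Sum>k\<in>{1..Suc n} - E. g (k - 1)) = (\<Sum>k\<in>{1..Suc n}. g (k - 1)) - (\<Sum>k\<in>E. g (k - 1))"
      by (intro sum_diff) auto
    also have "(\<Sum>k\<in>{1..Suc n}. g (k - 1)) = (\<Sum>k\<le>n. g k)"
      by (rule sum.reindex_bij_witness[of _ Suc "\<lambda>k. k - 1"]) auto
    finally show ?thesis .
  qed
  have Y: "Y k \<omega> = real (X k \<omega>)" "Y (k - 1) \<omega> = real (X (k - 1) \<omega>)" if "k \<in> {1..n} - E" for k n
    using that by (auto simp: Y_def Yobs_def E_def)
  have S2: "(\<Sum>k\<in>{1..Suc n} - E. (Y (k - 1) \<omega>)^2) = energy n \<omega> - (1 + e)" if "n \<ge> s2" for n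
  proof -
    have "(\<Sum>k\<in>{1..Suc n} - E. (Y (k - 1) \<omega>)^2) = (\<Sum>k\<in>{1..Suc n} - E. (real (X (k - 1) \<omega>))^2)"
      by (rule sum.cong) (simp_all only: Y)
    then show ?thesis using trim[OF that, of "\<lambda>k. (real (X k \<omega>))^2"] by (simp add: energy_def e_def)
  qed
  have N: "(\<Sum>k\<in>{1..Suc n} - E. Y (k - 1) \<omega> * (Y k \<omega> - \<alpha> * Y (k - 1) \<omega> - \<mu>)) = U n - c" if "n \<ge> s2" for n
  proof -
    have "(\<Sum>k\<in>{1..Suc n} - E. Y (k - 1) \<omega> * (Y k \<omega> - \<alpha> * Y (k - 1) \<omega> - \<mu>))
        = (\<Sum>k\<in>{1..Suc n} - E. real (X (k - 1) \<omega>) * resid (k - 1) \<omega>)"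
    proof (rule sum.cong)
      fix k assume k: "k \<in> {1..Suc n} - E"
      then have "Suc (k - 1) = k" by auto
      then show "Y (k - 1) \<omega> * (Y k \<omega> - \<alpha> * Y (k - 1) \<omega> - \<mu>) = real (X (k - 1) \<omega>) * resid (k - 1) \<omega>"
        by (simp only: Y[OF k])
    qed simp
    then show ?thesis using trim[OF that, of "\<lambda>k. real (X k \<omega>) * resid k \<omega>"] by (simp add: U_def c_def)
  qed
  have ev: "eventually (\<lambda>n. n \<ge> s2) sequentially" by (rule eventually_ge_at_top)
  have inv: "(\<lambda>n. x / energy n \<omega>) \<longlonglongrightarrow> 0" for x
    by (rule tendsto_divide_0[OF tendsto_const filterlim_at_top_imp_at_infinity[OF elim(1)]])
  have S2_eq: "\<forall>\<^sub>F n in sequentially.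
      - (1 + e) + energy n \<omega> = (\<Sum>k\<in>{1..Suc n} - E. (Y (k - 1) \<omega>)^2)"
    using ev
  proof eventually_elim
    case (elim n)
    show ?case unfolding S2[OF elim] by simp
  qed
  have "filterlim (\<lambda>n. - (1 + e) + energy n \<omega>) at_top sequentially"
    by (rule filterlim_tendsto_add_at_top[OF tendsto_const elim(1)])
  then have "filterlim (\<lambda>n. \<Sum>k\<in>{1..Suc n} - E. (Y (k - 1) \<omega>)^2) at_top sequentially"
    using filterlim_cong[OF refl refl S2_eq, THEN iffD1] by blast
  then have lim1: "filterlim (\<lambda>n. \<Sum>k\<in>{1..n} - E. (Y (k - 1) \<omega>)^2) at_top sequentially"
    by (subst (asm) filterlim_sequentially_Suc)
  \<comment> \<open>Numerator and denominator are both divided by the energy: the former then tends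
    to 0 and the latter to 1.\<close>
  have "(\<lambda>n. (U n / energy n \<omega> - c / energy n \<omega>) / (1 - (1 + e) / energy n \<omega>)) \<longlonglongrightarrow> (0 - 0) / (1 - 0)"
    unfolding U_def by (intro tendsto_intros inv elim(2)) simp
  moreover have "\<forall>\<^sub>F n in sequentially. (U n / energy n \<omega> - c / energy n \<omega>) / (1 - (1 + e) / energy n \<omega>)
     = (\<Sum>k\<in>{1..Suc n} - E. Y (k - 1) \<omega> * (Y k \<omega> - \<alpha> * Y (k - 1) \<omega> - \<mu>))
         / (\<Sum>k\<in>{1..Suc n} - E. (Y (k - 1) \<omega>)^2)"
    using ev
  proof eventually_elim
    case (elim n)
    have nz: "energy n \<omega> \<noteq> 0" using energy_ge_1[of n \<omega>] by linarith
    have "(U n / energy n \<omega> - c / energy n \<omega>) / (1 - (1 + e) / energy n \<omega>)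
        = ((U n - c) / energy n \<omega>) / ((energy n \<omega> - (1 + e)) / energy n \<omega>)"
      using nz by (simp add: diff_divide_distrib)
    also have "\<dots> = (U n - c) / (energy n \<omega> - (1 + e))" using nz by simp
    finally show ?case by (simp only: S2[OF elim] N[OF elim])
  qed
  ultimately have "(\<lambda>n. (\<Sum>k\<in>{1..Suc n} - E. Y (k - 1) \<omega> * (Y k \<omega> - \<alpha> * Y (k - 1) \<omega> - \<mu>))
         / (\<Sum>k\<in>{1..Suc n} - E. (Y (k - 1) \<omega>)^2)) \<longlonglongrightarrow> 0"
    using Lim_transform_eventually by fastforce
  then have lim2: "(\<lambda>n. (\<Sum>k\<in>{1..n} - E. Y (k - 1) \<omega> * (Y k \<omega> - \<alpha> * Y (k - 1) \<omega> - \<mu>))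
         / (\<Sum>k\<in>{1..n} - E. (Y (k - 1) \<omega>)^2)) \<longlonglongrightarrow> 0"
    by (subst (asm) filterlim_sequentially_Suc)
  note CLS = CLS_unique_and_consistent[where y = ?y and ?s1.0 = s1 and ?s2.0 = s2 and \<alpha> = \<alpha> and mu = \<mu>, folded E_def, OF lim1 lim2]
  show ?case by (intro conjI CLS)
qed

end

theorem theorem3p4p1:
  fixes M :: "'a measure"
    and X :: "nat \<Rightarrow> 'a \<Rightarrow> nat"
    and eps :: "nat \<Rightarrow> 'a \<Rightarrow> nat"
    and xi :: "nat \<Rightarrow> nat \<Rightarrow> 'a \<Rightarrow> nat"
    and \<alpha> :: real
    and s1 s2 \<theta>1 \<theta>2 :: nat
  assumes M: "prob_space M"
    and alpha: "0 < \<alpha>" "\<alpha> < 1"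
    and indep: "prob_space.indep_vars M (\<lambda>_. count_space UNIV)
        (case_sum (\<lambda>_. X 0) (case_sum eps (\<lambda>(k, j). xi k j)))
        ({Inl ()} \<union> Inr ` (Inl ` {1..} \<union> Inr ` ({1..} \<times> {1..})))"
    and eps_id: "\<forall>k\<ge>1. distr M (count_space UNIV) (eps k) = distr M (count_space UNIV) (eps 1)"
    and eps_sq: "integrable M (\<lambda>\<omega>. (real (eps 1 \<omega>))^2)"
    and eps_nz: "measure M {\<omega> \<in> space M. eps 1 \<omega> \<noteq> 0} > 0"
    and xi_bern: "\<forall>k\<ge>1. \<forall>j\<ge>1. (\<forall>\<omega>\<in>space M. xi k j \<omega> \<in> {0, 1})
        \<and> measure M {\<omega> \<in> space M. xi k j \<omega> = 1} = \<alpha>"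
    and X0_sq: "integrable M (\<lambda>\<omega>. (real (X 0 \<omega>))^2)"
    and recur: "\<forall>k\<ge>1. \<forall>\<omega>\<in>space M. X k \<omega> = (\<Sum>j\<in>{1..X (k-1) \<omega>}. xi k j \<omega>) + eps k \<omega>"
    and s: "1 \<le> s1" "s1 + 1 < s2"
    and theta: "1 \<le> \<theta>1" "1 \<le> \<theta>2"
  defines "\<mu> \<equiv> prob_space.expectation M (\<lambda>\<omega>. real (eps 1 \<omega>))"
    and "Y \<equiv> Yobs X s1 s2 \<theta>1 \<theta>2"
  shows "AE \<omega> in M.
      (\<exists>n0. \<forall>n\<ge>n0. \<exists>!p :: real \<times> real \<times> real. \<forall>q :: real \<times> real \<times> real.
          Qn \<mu> s1 s2 n (\<lambda>k. Y k \<omega>) (fst p) (fst (snd p)) (snd (snd p))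
            \<le> Qn \<mu> s1 s2 n (\<lambda>k. Y k \<omega>) (fst q) (fst (snd q)) (snd (snd q)))
    \<and> (\<lambda>n. fst (CLS_est \<mu> s1 s2 n (\<lambda>k. Y k \<omega>))) \<longlonglongrightarrow> \<alpha>
    \<and> (\<lambda>n. fst (snd (CLS_est \<mu> s1 s2 n (\<lambda>k. Y k \<omega>)))) \<longlonglongrightarrow>
        Y s1 \<omega> - \<alpha> / (1 + \<alpha>^2) * (Y (s1-1) \<omega> + Y (s1+1) \<omega>) - (1 - \<alpha>) / (1 + \<alpha>^2) * \<mu>
    \<and> (\<lambda>n. snd (snd (CLS_est \<mu> s1 s2 n (\<lambda>k. Y k \<omega>)))) \<longlonglongrightarrow>
        Y s2 \<omega> - \<alpha> / (1 + \<alpha>^2) * (Y (s2-1) \<omega> + Y (s2+1) \<omega>) - (1 - \<alpha>) / (1 + \<alpha>^2) * \<mu>"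
proof -
  note mu = \<mu>_def
  interpret prob_space M by (rule M)
  interpret I: INAR1 M X eps xi \<alpha>
    using alpha indep eps_id eps_sq eps_nz xi_bern X0_sq recur by unfold_locales
  show ?thesis
    using I.CLS_consistent[OF s, of \<theta>1 \<theta>2]
    unfolding mu Y_def I.\<mu>_def outlier_profile_def .
qed

end
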